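(* Let $f:\mathbb R^n\to\mathbb R^n$ be smooth, let $p,q$ be positive integers, $m=p+q$, $h>0$ a real number, $[x_k],[\widetilde y]\subset\mathbb R^n$ interval vectors and $[\widetilde V]\subset\mathbb R^{n\times n}$ an interval matrix such that for every $x\in[x_k]$ the solution $\varphi(\cdot,x)$ of $\dot x=f(x)$ exists on $[0,h]$ and $$\varphi([0,h],[x_k])\subset[\widetilde y],\qquad \psi([0,h],[x_k],I)\subset[\widetilde V].$$ Let $([x^0_{k+1}],[r^0],[V^0],[R^0])$ be the quadruple returned by the Predictor algorithm for the input $(m,h,[x_k],[\widetilde y],[\widetilde V])$, and let $([x_{k+1}],[V])$ be the pair computed by the Corrector algorithm for the input $(p,q,h,[x_k],([x^0_{k+1}],[r^0],[V^0],[R^0]))$, where the midpoint matrix $\widehat J_-$ arising in the Corrector algorithm is invertible. (Both algorithms are given in the context.) Then $$\varphi(h,[x_k])\subset[x_{k+1}]\qquad\text{and}\qquad \psi(h,[x_k],I)\subset[V].$$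
   Context: Notation. $\varphi(t,x)$ is the local flow of $\dot x=f(x)$; $\psi(t,x,V)=D_x\varphi(t,x)\cdot V$ for $V\in\mathbb R^{n\times n}$, i.e. the solution of the variational equation $\dot V(t)=Df(\varphi(t,x))V(t)$, $V(0)=V$. $I$ is the identity matrix. $\varphi^{[i]}(t,x)=\frac1{i!}\partial_t^i\varphi(t,x)$ and $\psi^{[i]}(t,x,V)=\frac1{i!}\partial_t^i\psi(t,x,V)$ are Taylor coefficients in time. Interval objects (in square brackets) are Cartesian products of compact intervals, regarded as subsets of $\mathbb R^n$ or $\mathbb R^{n\times n}$. $\widehat{a}$ is the midpoint (componentwise) of an interval object $[a]$; e.g. $\widehat x_k$, $\widehat x^0_{k+1}$, $\widehat J_-$ are the midpoints of $[x_k]$, $[x^0_{k+1}]$, $[J_-]$. Functions applied to sets denote images. Expressions in the algorithms are evaluated in interval arithmetic: an assignment "$[a]\leftarrow$ expression" means that $[a]$ is an interval object containing all values of the expression obtained when each interval operand is replaced, independently, by an arbitrary element of it, and each function value such as $\varphi^{[i]}(0,[x])$ or $\psi^{[i]}(0,[x],I)$ by any element of an interval object containing the whole range over $[x]$ (point quantities such as $y_0$ may likewise be replaced by interval enclosures). An intersection of interval objects is an actual set intersection. For natural numbers with $i\le q$ put $c_i^{q,p}=\binom{q}{i}/\binom{p+q}{i}$, and for $x\in\mathbb R^n$, $s\in\mathbb R$ put $$\Psi_{q,p}(s,x,0)=\sum_{i=0}^{q}c_i^{q,p}s^i\varphi^{[i]}(0,x),\qquad D_x\Psi_{q,p}(s,x,0)=\sum_{i=0}^{q}c_i^{q,p}s^i\psi^{[i]}(0,x,I),$$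 and similarly for $\Psi_{p,q}$ with the roles of $p$ and $q$ exchanged. $[D_x\Psi(s,[x],0)]$ is an interval matrix containing $D_x\Psi(s,x,0)$ for all $x\in[x]$. Predictor algorithm. Input: $m,h,[x_k],[\widetilde y],[\widetilde V]$. Compute - $[A]\leftarrow\sum_{i=0}^m h^i\psi^{[i]}(0,[x_k],I)$; - $y_0\leftarrow\sum_{i=0}^m h^i\varphi^{[i]}(0,\widehat x_k)$; - $[y]\leftarrow\sum_{i=0}^m h^i\varphi^{[i]}(0,[x_k])$; - $[r^0]\leftarrow[0,h]^{m+1}\varphi^{[m+1]}(0,[\widetilde y])$; - $[x^0_{k+1}]\leftarrow\big((y_0+[A]([x_k]-\widehat x_k))\cap[y]\big)+[r^0]$; - $[R^0]\leftarrow[0,h]^{m+1}\psi^{[m+1]}(0,[\widetilde y],I)[\widetilde V]$; - $[V^0]\leftarrow[A]+[R^0]$. Return $([x^0_{k+1}],[r^0],[V^0],[R^0])$. Corrector algorithm. Input: $p,q,h,[x_k]$ and the output $([x^0_{k+1}],[r^0],[V^0],[R^0])$ of the Predictor with $m=p+q$. Compute - $[\delta]\leftarrow\Psi_{p,q}(h,\widehat x_k,0)-\Psi_{q,p}(-h,\widehat x^0_{k+1},0)$; - $[\varepsilon]\leftarrow(-1)^qc_q^{q,p}[r^0]$; - $[J_-]\leftarrow[D_x\Psi_{q,p}(-h,[x^0_{k+1}],0)]$; - $[J_+]\leftarrow[D_x\Psi_{p,q}(h,[x_k],0)]$; - $[S]\leftarrow I-\widehat J_-^{-1}[J_-]$;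 - $[r]\leftarrow\widehat J_-^{-1}([\delta]+[\varepsilon])+[S]([x^0_{k+1}]-\widehat x^0_{k+1})$; - $[R]\leftarrow\widehat J_-^{-1}\big([J_+]+(-1)^qc_q^{q,p}[R^0]\big)$; - $[x_{k+1}]\leftarrow\big(\widehat x^0_{k+1}+(\widehat J_-^{-1}[J_+])([x_k]-\widehat x_k)+[r]\big)\cap[x^0_{k+1}]$; - $[V]\leftarrow([R]+[S][V^0])\cap[V^0]$. Return $([x_{k+1}],[V])$. *)

theory Defs
  imports "HOL-Analysis.Analysis"
begin

text \<open>\<open>C_k k f\<close> says that \<open>f\<close> is \<open>k\<close> times continuously differentiable; on a
  finite-dimensional domain it suffices to require this of all directional derivatives of the
  (total) derivative.\<close>

primrec C_k :: "nat \<Rightarrow> ('a::euclidean_space \<Rightarrow> 'b::euclidean_space) \<Rightarrow> bool" where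
  "C_k 0 f \<longleftrightarrow> continuous_on UNIV f"
| "C_k (Suc k) f \<longleftrightarrow>
     f differentiable_on UNIV \<and> (\<forall>v. C_k k (\<lambda>x. frechet_derivative f (at x) v))"

definition smooth :: "('a::euclidean_space \<Rightarrow> 'b::euclidean_space) \<Rightarrow> bool" where
  "smooth f \<longleftrightarrow> (\<forall>k. C_k k f)"

definition ivp_solution ::
  "('a::euclidean_space \<Rightarrow> 'a) \<Rightarrow> 'a \<Rightarrow> real set \<Rightarrow> (real \<Rightarrow> 'a) \<Rightarrow> bool" where
  "ivp_solution f x T y \<longleftrightarrow>
     is_interval T \<and> 0 \<in> T \<and> y 0 = x \<and>
     (\<forall>t\<in>T. (y has_vector_derivative f (y t)) (at t within T))"

definition existence_ivl :: "('a::euclidean_space \<Rightarrow> 'a) \<Rightarrow> 'a \<Rightarrow> real set" where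
  "existence_ivl f x = \<Union> {T. \<exists>y. ivp_solution f x T y}"

text \<open>For \<open>t \<in> existence_ivl f x\<close> and locally Lipschitz \<open>f\<close> the value below is unique. Outside
  the existence interval it is unspecified.\<close>

definition flow :: "('a::euclidean_space \<Rightarrow> 'a) \<Rightarrow> real \<Rightarrow> 'a \<Rightarrow> 'a" where
  "flow f t x = (THE z. \<exists>T y. ivp_solution f x T y \<and> t \<in> T \<and> z = y t)"

definition var_flow ::
  "(real^'n \<Rightarrow> real^'n) \<Rightarrow> real \<Rightarrow> real^'n \<Rightarrow> real^'n^'n \<Rightarrow> real^'n^'n" where
  "var_flow f t x V = matrix (frechet_derivative (\<lambda>z. flow f t z) (at x)) ** V"

definition taylor_coeff :: "nat \<Rightarrow> (real \<Rightarrow> 'b::real_normed_vector) \<Rightarrow> real \<Rightarrow> 'b" where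
  "taylor_coeff i g t =
     (1 / fact i) *\<^sub>R ((\<lambda>u s. vector_derivative u (at s)) ^^ i) g t"

definition flow_coeff ::
  "(real^'n \<Rightarrow> real^'n) \<Rightarrow> nat \<Rightarrow> real \<Rightarrow> real^'n \<Rightarrow> real^'n" where
  "flow_coeff f i t x = taylor_coeff i (\<lambda>s. flow f s x) t"

definition var_flow_coeff ::
  "(real^'n \<Rightarrow> real^'n) \<Rightarrow> nat \<Rightarrow> real \<Rightarrow> real^'n \<Rightarrow> real^'n^'n \<Rightarrow> real^'n^'n" where
  "var_flow_coeff f i t x V = taylor_coeff i (\<lambda>s. var_flow f s x V) t"

definition ho_c :: "nat \<Rightarrow> nat \<Rightarrow> nat \<Rightarrow> real" where
  "ho_c q p i = real (q choose i) / real ((p + q) choose i)"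

definition HO :: "(real^'n \<Rightarrow> real^'n) \<Rightarrow> nat \<Rightarrow> nat \<Rightarrow> real \<Rightarrow> real^'n \<Rightarrow> real^'n" where
  "HO f q p s x = (\<Sum>i\<le>q. (ho_c q p i * s ^ i) *\<^sub>R flow_coeff f i 0 x)"

definition D_HO :: "(real^'n \<Rightarrow> real^'n) \<Rightarrow> nat \<Rightarrow> nat \<Rightarrow> real \<Rightarrow> real^'n \<Rightarrow> real^'n^'n" where
  "D_HO f q p s x = (\<Sum>i\<le>q. (ho_c q p i * s ^ i) *\<^sub>R var_flow_coeff f i 0 x (mat 1))"

text \<open>The order on \<open>real^'n\<close> and \<open>real^'n^'n\<close> is componentwise, so \<open>{a..b}\<close> is a product of
  compact intervals, and \<open>Inf\<close>, \<open>Sup\<close> of a nonempty such box are its corners. The empty set is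
  admitted, so that interval objects are closed under intersection.\<close>

definition interval_object :: "'a::ordered_euclidean_space set \<Rightarrow> bool" where
  "interval_object X \<longleftrightarrow> (\<exists>a b. X = {a..b})"

definition mid :: "'a::ordered_euclidean_space set \<Rightarrow> 'a" where
  "mid X = midpoint (Inf X) (Sup X)"

text \<open>Interval assignment: the interval object \<open>X\<close> contains all values in \<open>S\<close>. The same
  predicate expresses that \<open>X\<close> encloses the range of a function.\<close>

definition encloses :: "'a::ordered_euclidean_space set \<Rightarrow> 'a set \<Rightarrow> bool" where
  "encloses X S \<longleftrightarrow> interval_object X \<and> S \<subseteq> X"

text \<open>Both algorithms are relations between input and output, since interval evaluation only
  determines an enclosure. \<open>\<Phi> i\<close>, \<open>\<Psi> i\<close> are the interval enclosures substituted for the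
  coefficients \<open>i\<close> over \<open>xk\<close>, and \<open>\<Phi>r\<close>, \<open>\<Psi>r\<close> those of order \<open>m + 1\<close> over \<open>ytil\<close>; \<open>B\<close> is the
  interval value of the operand that is intersected. Evaluating a point quantity by an interval
  enclosure only enlarges results, hence is covered by \<open>encloses\<close>.\<close>

definition predictor ::
  "(real^'n \<Rightarrow> real^'n) \<Rightarrow> nat \<Rightarrow> real \<Rightarrow> (real^'n) set \<Rightarrow> (real^'n) set \<Rightarrow> (real^'n^'n) set \<Rightarrow>
   (real^'n) set \<Rightarrow> (real^'n) set \<Rightarrow> (real^'n^'n) set \<Rightarrow> (real^'n^'n) set \<Rightarrow> bool" where
  "predictor f m h xk ytil Vtil x0 r0 V0 R0 \<longleftrightarrow>
    (\<exists>\<Phi> \<Psi> \<Phi>r \<Psi>r A y0 y B.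
      (\<forall>i\<le>m. encloses (\<Phi> i) ((\<lambda>x. flow_coeff f i 0 x) ` xk)) \<and>
      (\<forall>i\<le>m. encloses (\<Psi> i) ((\<lambda>x. var_flow_coeff f i 0 x (mat 1)) ` xk)) \<and>
      encloses \<Phi>r ((\<lambda>x. flow_coeff f (m + 1) 0 x) ` ytil) \<and>
      encloses \<Psi>r ((\<lambda>x. var_flow_coeff f (m + 1) 0 x (mat 1)) ` ytil) \<and>
      encloses A {\<Sum>i\<le>m. h ^ i *\<^sub>R M i | M. \<forall>i\<le>m. M i \<in> \<Psi> i} \<and>
      encloses y0 {\<Sum>i\<le>m. h ^ i *\<^sub>R flow_coeff f i 0 (mid xk)} \<and>
      encloses y {\<Sum>i\<le>m. h ^ i *\<^sub>R v i | v. \<forall>i\<le>m. v i \<in> \<Phi> i} \<and>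
      encloses r0 {s ^ (m + 1) *\<^sub>R v | s v. s \<in> {0..h} \<and> v \<in> \<Phi>r} \<and>
      encloses B {u + a *v (x - mid xk) | u a x. u \<in> y0 \<and> a \<in> A \<and> x \<in> xk} \<and>
      encloses x0 {b + r | b r. b \<in> B \<inter> y \<and> r \<in> r0} \<and>
      encloses R0 {s ^ (m + 1) *\<^sub>R (M ** W) | s M W. s \<in> {0..h} \<and> M \<in> \<Psi>r \<and> W \<in> Vtil} \<and>
      encloses V0 {a + R | a R. a \<in> A \<and> R \<in> R0})"

text \<open>The interval matrix \<open>Jm\<close> is an explicit argument so that invertibility of its midpoint can
  be stated.\<close>

definition corrector ::
  "(real^'n \<Rightarrow> real^'n) \<Rightarrow> nat \<Rightarrow> nat \<Rightarrow> real \<Rightarrow> (real^'n) set \<Rightarrow>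
   (real^'n) set \<Rightarrow> (real^'n) set \<Rightarrow> (real^'n^'n) set \<Rightarrow> (real^'n^'n) set \<Rightarrow>
   (real^'n^'n) set \<Rightarrow> (real^'n) set \<Rightarrow> (real^'n^'n) set \<Rightarrow> bool" where
  "corrector f p q h xk x0 r0 V0 R0 Jm xk1 V \<longleftrightarrow>
    (\<exists>\<delta> \<epsilon> Jp S r R B C.
      encloses \<delta> {HO f p q h (mid xk) - HO f q p (- h) (mid x0)} \<and>
      encloses \<epsilon> {((- 1) ^ q * ho_c q p q) *\<^sub>R v | v. v \<in> r0} \<and>
      encloses Jm ((\<lambda>x. D_HO f q p (- h) x) ` x0) \<and>
      encloses Jp ((\<lambda>x. D_HO f p q h x) ` xk) \<and>
      encloses S {mat 1 - matrix_inv (mid Jm) ** M | M. M \<in> Jm} \<and>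
      encloses r {matrix_inv (mid Jm) *v (d + e) + s *v (x - mid x0) | d e s x.
                    d \<in> \<delta> \<and> e \<in> \<epsilon> \<and> s \<in> S \<and> x \<in> x0} \<and>
      encloses R {matrix_inv (mid Jm) ** (M + ((- 1) ^ q * ho_c q p q) *\<^sub>R N) | M N.
                    M \<in> Jp \<and> N \<in> R0} \<and>
      encloses B {mid x0 + (matrix_inv (mid Jm) ** M) *v (x - mid xk) + v | M x v.
                    M \<in> Jp \<and> x \<in> xk \<and> v \<in> r} \<and>
      encloses xk1 (B \<inter> x0) \<and>
      encloses C {a + s ** W | a s W. a \<in> R \<and> s \<in> S \<and> W \<in> V0} \<and>
      encloses V (C \<inter> V0))"

end

theory Submission
  imports Defs "HOL-Computational_Algebra.Polynomial"
begin

text \<open>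
  Both algorithms evaluate, in interval arithmetic, identities that the exact flow satisfies. Hence it
  suffices to prove these identities, with every remainder evaluated at points where the input
  enclosures apply.

  The basic identity is the Hermite-Obreshkov formula (\<open>hermite_obreshkov\<close>), a two-point Taylor formula for
  real functions on \<open>[0, h]\<close>; its special case \<open>q = 0\<close> is Taylor's formula, which is all the predictor needs.
  Applied to the coordinates of the flow and to the entries of the variational flow, it relates the
  points \<open>x\<close> and \<open>y = flow f h x\<close> by
  \<open>HO f q p (- h) y = HO f p q h x + remainder\<close>, and likewise with \<open>D_HO\<close>
  (\<open>hermite_obreshkov_flow\<close>, \<open>hermite_obreshkov_var_flow\<close>). The mean value theorem around the midpoints
  (\<open>interval_mean_value\<close>) makes the first relation affine in \<open>y\<close>, and preconditioning with the inverse of the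
  midpoint matrix, as in the interval Newton method, gives the formulas of the corrector. All these
  results use a different intermediate point for each coordinate, which is harmless because
  interval objects are boxes (\<open>interval_object_vec_mem\<close>, \<open>interval_object_mat_mem\<close>).

  For this, time derivatives of all orders of the flow and of its space derivative must be known on
  \<open>[0, h]\<close>. The flow is constructed by the Picard-Lindeloef theorem for a cut-off vector field, and its
  differentiability in space follows from Gronwall's inequality (\<open>flow_variational\<close>). Time
  derivatives of the flow are iterated Lie derivatives of the identity map, and those of the
  variational flow are their Jacobians (\<open>flow_derivatives\<close>, \<open>flow_coeff_eq_lie\<close>). In other words, time and
  space derivatives commute, which rests on the symmetry of second derivatives.
\<close>

section \<open>Smooth maps and symmetry of second derivatives\<close>

text \<open>A Lie derivative, expanded in a basis, is a finite sum of products of components of the vector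
  field with directional derivatives. The following closure properties make it smooth again, so that it
  can be iterated.\<close>

lemma C_k_Suc_imp_C_k: "C_k (Suc k) f \<Longrightarrow> C_k k f"
proof (induction k arbitrary: f)
  case 0
  then show ?case by (auto intro: differentiable_imp_continuous_on)
next
  case (Suc k)
  then show ?case by simp
qed

lemma C_k_const: "C_k k (\<lambda>x. c)"
  by (induction k arbitrary: c) (simp_all add: frechet_derivative_const)

lemma C_k_add: "C_k k f \<Longrightarrow> C_k k g \<Longrightarrow> C_k k (\<lambda>x. f x + g x)"
proof (induction k arbitrary: f g)
  case 0
  then show ?case by (auto intro: continuous_intros)
next
  case (Suc k)
  then have d: "f differentiable at x" "g differentiable at x" for x
    by (auto simp: differentiable_on_def)
  have "frechet_derivative (\<lambda>x. f x + g x) (at x)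
      = (\<lambda>v. frechet_derivative f (at x) v + frechet_derivative g (at x) v)" for x
    using d[of x] by (intro frechet_derivative_at[symmetric])
      (auto intro!: has_derivative_add simp: frechet_derivative_works)
  with Suc d show ?case by (auto simp: differentiable_on_def)
qed

lemma C_k_scaleR:
  "C_k k g \<Longrightarrow> C_k k u \<Longrightarrow> C_k k (\<lambda>x. g x *\<^sub>R u x)"
proof (induction k arbitrary: g u)
  case 0
  then show ?case by (auto intro: continuous_intros)
next
  case (Suc k)
  then have d: "g differentiable at x" "u differentiable at x" for x
    by (auto simp: differentiable_on_def)
  then have h: "(g has_derivative frechet_derivative g (at x)) (at x)"
    "(u has_derivative frechet_derivative u (at x)) (at x)" for x
    by (auto simp: frechet_derivative_works)
  have "frechet_derivative (\<lambda>x. g x *\<^sub>R u x) (at x)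
      = (\<lambda>v. g x *\<^sub>R frechet_derivative u (at x) v + frechet_derivative g (at x) v *\<^sub>R u x)" for x
    by (intro frechet_derivative_at[symmetric] has_derivative_scaleR h)
  moreover have "C_k k g" "C_k k u" using Suc.prems C_k_Suc_imp_C_k by blast+
  moreover have "(\<lambda>x. g x *\<^sub>R u x) differentiable at x" for x
    using has_derivative_scaleR[OF h] differentiableI by blast
  ultimately show ?case using Suc by (auto simp: differentiable_on_def intro!: C_k_add)
qed

lemma C_k_sum: "finite A \<Longrightarrow> (\<And>a. a \<in> A \<Longrightarrow> C_k k (f a)) \<Longrightarrow> C_k k (\<lambda>x. \<Sum>a\<in>A. f a x)"
  by (induction A rule: finite_induct) (auto intro: C_k_add C_k_const)

lemma C_k_inner_left: "C_k k f \<Longrightarrow> C_k k (\<lambda>x. f x \<bullet> c)"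
proof (induction k arbitrary: f)
  case 0
  then show ?case by (auto intro: continuous_intros)
next
  case (Suc k)
  then have h: "(f has_derivative frechet_derivative f (at x)) (at x)" for x
    by (auto simp: differentiable_on_def frechet_derivative_works)
  have "frechet_derivative (\<lambda>x. f x \<bullet> c) (at x) = (\<lambda>v. frechet_derivative f (at x) v \<bullet> c)" for x
    by (intro frechet_derivative_at[symmetric] has_derivative_inner_left h)
  moreover have "(\<lambda>x. f x \<bullet> c) differentiable at x" for x
    using has_derivative_inner_left[OF h] differentiableI by blast
  ultimately show ?case using Suc by (auto simp: differentiable_on_def)
qed

lemma smooth_frechet_derivative: "smooth f \<Longrightarrow> smooth (\<lambda>x. frechet_derivative f (at x) v)"
  unfolding smooth_def using C_k.simps(2) by blast

lemma smooth_has_derivative: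
  assumes "smooth f" shows "(f has_derivative frechet_derivative f (at x)) (at x)"
proof -
  have "C_k (Suc 0) f" using assms smooth_def by blast
  then show ?thesis by (auto simp: differentiable_on_def frechet_derivative_works)
qed

lemma smooth_continuous: "smooth f \<Longrightarrow> continuous_on S f"
  unfolding smooth_def by (metis C_k.simps(1) continuous_on_subset subset_UNIV)

text \<open>The derivative as an element of the Banach space of bounded linear maps, so that it has a
  norm, and so that the variational equation is an ordinary differential equation in a Banach space.\<close>

definition blinfun_deriv :: "('a::euclidean_space \<Rightarrow> 'b::euclidean_space) \<Rightarrow> 'a \<Rightarrow> 'a \<Rightarrow>\<^sub>L 'b" where
  "blinfun_deriv f x = Blinfun (frechet_derivative f (at x))"

lemma blinfun_deriv_apply:
  assumes "smooth f" shows "blinfun_apply (blinfun_deriv f x) = frechet_derivative f (at x)"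
  using smooth_has_derivative[OF assms] unfolding blinfun_deriv_def
  by (meson bounded_linear_Blinfun_apply has_derivative_bounded_linear)

lemma has_derivative_blinfun_deriv:
  "smooth f \<Longrightarrow> (f has_derivative blinfun_apply (blinfun_deriv f x)) (at x within S)"
  using smooth_has_derivative[of f x] by (simp add: blinfun_deriv_apply has_derivative_at_withinI)

lemma smooth_blinfun_deriv: "smooth f \<Longrightarrow> smooth (\<lambda>x. blinfun_deriv f x v)"
  by (simp add: blinfun_deriv_apply smooth_frechet_derivative)

lemma continuous_on_blinfun_deriv:
  assumes "smooth f" shows "continuous_on S (blinfun_deriv f)"
  by (intro continuous_on_blinfun_componentwise smooth_continuous smooth_blinfun_deriv assms)

lemma blinfun_deriv_eq:
  assumes "smooth f" "(f has_derivative f') (at x)" shows "blinfun_apply (blinfun_deriv f x) = f'"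
  using assms by (metis blinfun_deriv_apply frechet_derivative_at)

text \<open>The Lie derivative of \<open>F\<close> along the vector field \<open>f\<close>: the time derivative of \<open>F\<close> along
  solutions.\<close>

definition lie :: "('a::euclidean_space \<Rightarrow> 'a) \<Rightarrow> ('a \<Rightarrow> 'b::euclidean_space) \<Rightarrow> 'a \<Rightarrow> 'b" where
  "lie f F x = blinfun_deriv F x (f x)"

lemma blinfun_apply_sum_Basis:
  "blinfun_apply A w = (\<Sum>b\<in>Basis. (w \<bullet> b) *\<^sub>R A b)"
proof -
  have "A w = A (\<Sum>b\<in>Basis. (w \<bullet> b) *\<^sub>R b)" by (simp add: euclidean_representation)
  then show ?thesis by (simp add: blinfun.sum_right blinfun.scaleR_right)
qed

lemma lie_sum_Basis:
  "lie f F = (\<lambda>x. \<Sum>b\<in>Basis. (f x \<bullet> b) *\<^sub>R blinfun_deriv F x b)"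
  unfolding lie_def[abs_def] by (subst blinfun_apply_sum_Basis) simp

lemma smooth_lie:
  assumes "smooth f" "smooth F" shows "smooth (lie f F)"
  using assms smooth_blinfun_deriv[OF assms(2)] unfolding lie_sum_Basis smooth_def
  by (auto intro!: C_k_sum C_k_scaleR C_k_inner_left)

lemma smooth_id: "smooth (\<lambda>x. x)"
proof -
  have "C_k k (\<lambda>x::'a. x)" for k
    by (cases k) (simp_all add: C_k_const)
  then show ?thesis by (simp add: smooth_def)
qed

text \<open>The second difference over the parallelogram spanned by \<open>e u\<close> and \<open>e v\<close> is an increment of an
  increment; the mean value theorem applied twice, first in direction \<open>u\<close>, then in direction \<open>v\<close>, turns it
  into a mixed second derivative at a point of the parallelogram. The left-hand side is symmetric in
  \<open>u\<close> and \<open>v\<close>, so letting \<open>e\<close> tend to 0 gives the symmetry of second derivatives.\<close>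

lemma second_difference_real:
  fixes g :: "'a::euclidean_space \<Rightarrow> real"
  assumes g: "smooth g" and e: "e > 0"
  shows "\<exists>s\<in>{0<..<e}. \<exists>t\<in>{0<..<e}.
    g (x + e *\<^sub>R u + e *\<^sub>R v) - g (x + e *\<^sub>R u) - g (x + e *\<^sub>R v) + g x
     = e\<^sup>2 * blinfun_deriv (\<lambda>y. blinfun_deriv g y u) (x + s *\<^sub>R u + t *\<^sub>R v) v"
proof -
  define G where "G s = g (x + s *\<^sub>R u + e *\<^sub>R v) - g (x + s *\<^sub>R u)" for s
  define G' where "G' s = blinfun_deriv g (x + s *\<^sub>R u + e *\<^sub>R v) u - blinfun_deriv g (x + s *\<^sub>R u) u" for s
  have chain: "((\<lambda>s. k (a + s *\<^sub>R w)) has_real_derivative blinfun_deriv k (a + s *\<^sub>R w) w) (at s)"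
    if "smooth k" for k :: "'a \<Rightarrow> real" and a w s
  proof -
    have "((\<lambda>s. k (a + s *\<^sub>R w)) has_derivative (\<lambda>r. blinfun_deriv k (a + s *\<^sub>R w) (r *\<^sub>R w))) (at s)"
      by (rule has_derivative_compose[OF _ has_derivative_blinfun_deriv[OF that]])
        (auto intro!: derivative_eq_intros)
    then show ?thesis
      by (simp add: has_field_derivative_def blinfun.scaleR_right mult_commute_abs)
  qed
  have "(G has_real_derivative G' s) (at s)" for s
    unfolding G_def G'_def
    using chain[OF g, of "x + e *\<^sub>R v" u s] chain[OF g, of x u s]
    by (auto intro!: derivative_eq_intros simp: add_ac)
  from MVT2[OF e this]
  obtain s where s: "0 < s" "s < e" "G e - G 0 = e * G' s" by auto
  have "((\<lambda>t. blinfun_deriv g (x + s *\<^sub>R u + t *\<^sub>R v) u) has_real_derivative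
     blinfun_deriv (\<lambda>y. blinfun_deriv g y u) (x + s *\<^sub>R u + t *\<^sub>R v) v) (at t)" for t
    using chain[OF smooth_blinfun_deriv[OF g]] .
  from MVT2[OF e this]
  obtain t where t: "0 < t" "t < e"
    "G' s = e * blinfun_deriv (\<lambda>y. blinfun_deriv g y u) (x + s *\<^sub>R u + t *\<^sub>R v) v"
    unfolding G'_def by auto
  show ?thesis
    using s t by (intro bexI[of _ s] bexI[of _ t]) (auto simp: G_def power2_eq_square algebra_simps)
qed

lemma tendsto_shrinking_parallelogram:
  fixes g :: "'a::real_normed_vector \<Rightarrow> real"
  assumes g: "isCont g x" and st: "\<And>e. e > 0 \<Longrightarrow> s e \<in> {0<..<e} \<and> t e \<in> {0<..<e::real}"
  shows "((\<lambda>e. g (x + s e *\<^sub>R u + t e *\<^sub>R v)) \<longlongrightarrow> g x) (at_right 0)"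
proof -
  have lim: "(r \<longlongrightarrow> 0) (at_right 0)"
    if "\<And>e. e > 0 \<Longrightarrow> r e \<in> {0<..<e}" for r :: "real \<Rightarrow> real"
  proof (rule tendsto_sandwich[of "\<lambda>_. 0" _ _ "\<lambda>e. e"])
    show "\<forall>\<^sub>F e in at_right 0. 0 \<le> r e" "\<forall>\<^sub>F e in at_right 0. r e \<le> e"
      using that by (auto simp: eventually_at_filter less_imp_le)
  qed auto
  have "((\<lambda>e. x + s e *\<^sub>R u + t e *\<^sub>R v) \<longlongrightarrow> x + 0 *\<^sub>R u + 0 *\<^sub>R v) (at_right 0)"
    by (intro tendsto_intros lim; use st in blast)
  then show ?thesis by (intro isCont_tendsto_compose[OF g]) simp
qed

lemma second_derivative_symmetric_real:
  fixes g :: "'a::euclidean_space \<Rightarrow> real"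
  assumes g: "smooth g"
  shows "blinfun_deriv (\<lambda>y. blinfun_deriv g y u) x v = blinfun_deriv (\<lambda>y. blinfun_deriv g y v) x u"
proof -
  define H where "H u v y = blinfun_deriv (\<lambda>y. blinfun_deriv g y u) y v" for u v y
  define D where "D u v e = (g (x + e *\<^sub>R u + e *\<^sub>R v) - g (x + e *\<^sub>R u) - g (x + e *\<^sub>R v) + g x) / e\<^sup>2" for u v and e::real
  have H: "isCont (H u v) x" for u v
    using smooth_continuous[OF smooth_blinfun_deriv[OF smooth_blinfun_deriv[OF g]], of UNIV]
    unfolding H_def by (simp add: continuous_on_eq_continuous_at)
  have lim: "(D u v \<longlongrightarrow> H u v x) (at_right 0)" for u v
  proof -
    have "\<exists>r. e > 0 \<longrightarrow> fst r \<in> {0<..<e} \<and> snd r \<in> {0<..<e} \<and>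
        D u v e = H u v (x + fst r *\<^sub>R u + snd r *\<^sub>R v)" for e
    proof (cases "e > 0")
      case True
      from second_difference_real[OF g this, of x u v] obtain s t
        where "s \<in> {0<..<e}" "t \<in> {0<..<e}" "D u v e = H u v (x + s *\<^sub>R u + t *\<^sub>R v)"
        unfolding D_def H_def using True by auto
      then show ?thesis by (intro exI[of _ "(s, t)"]) auto
    qed simp
    then obtain r where r: "\<And>e. e > 0 \<longrightarrow> fst (r e) \<in> {0<..<e} \<and> snd (r e) \<in> {0<..<e} \<and>
        D u v e = H u v (x + fst (r e) *\<^sub>R u + snd (r e) *\<^sub>R v)" by metis
    define s t where "s e = fst (r e)" and "t e = snd (r e)" for e
    have st: "\<And>e. e > 0 \<Longrightarrow> s e \<in> {0<..<e} \<and> t e \<in> {0<..<e}"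
      "\<And>e. e > 0 \<Longrightarrow> D u v e = H u v (x + s e *\<^sub>R u + t e *\<^sub>R v)"
      using r by (auto simp: s_def t_def)
    show ?thesis
      using tendsto_shrinking_parallelogram[where u=u and v=v, OF H[of u v] st(1)]
      by (rule Lim_transform_eventually) (auto simp: st(2) eventually_at_filter)
  qed
  have "D u v = D v u" unfolding D_def by (auto simp: algebra_simps)
  then show ?thesis
    using tendsto_unique[OF _ lim[of u v]] lim[of v u] unfolding H_def by simp
qed

lemma second_derivative_symmetric:
  assumes g: "smooth g"
  shows "blinfun_deriv (\<lambda>y. blinfun_deriv g y u) x v = blinfun_deriv (\<lambda>y. blinfun_deriv g y v) x u"
proof (rule euclidean_eqI)
  fix b :: 'b assume "b \<in> Basis"
  have sm: "smooth (\<lambda>y. k y \<bullet> b)" if "smooth k" for k :: "'a \<Rightarrow> 'b"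
    using that by (auto simp: smooth_def intro: C_k_inner_left)
  have comp: "blinfun_apply (blinfun_deriv (\<lambda>y. k y \<bullet> b) x) = (\<lambda>v. blinfun_deriv k x v \<bullet> b)"
    if "smooth k" for k :: "'a \<Rightarrow> 'b" and x
    by (intro blinfun_deriv_eq sm has_derivative_inner_left has_derivative_blinfun_deriv that)
  have "smooth (\<lambda>y. g y \<bullet> b)" by (rule sm[OF g])
  from second_derivative_symmetric_real[OF this, of u x v]
  show "blinfun_deriv (\<lambda>y. blinfun_deriv g y u) x v \<bullet> b = blinfun_deriv (\<lambda>y. blinfun_deriv g y v) x u \<bullet> b"
    by (simp add: comp g smooth_blinfun_deriv)
qed

section \<open>Gronwall estimate and the Picard-Lindeloef theorem\<close>

text \<open>Working with the square of the norm keeps everything differentiable where \<open>u\<close> vanishes: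
  with \<open>C = 2 L + 1\<close> the bound gives \<open>(|u|^2)' \<le> C (|u|^2 + \<epsilon>^2)\<close>, so that
  \<open>exp (- C s) (|u s|^2 + \<epsilon>^2)\<close> is nonincreasing.\<close>

lemma gronwall_forward:
  fixes u :: "real \<Rightarrow> 'a::real_inner"
  assumes t: "t \<ge> 0"
    and d: "\<And>s. s \<in> {0..t} \<Longrightarrow> (u has_vector_derivative u' s) (at s within {0..t})"
    and b: "\<And>s. s \<in> {0..t} \<Longrightarrow> norm (u' s) \<le> L * norm (u s) + \<epsilon>"
    and L: "L \<ge> 0" and \<epsilon>: "\<epsilon> \<ge> 0"
  shows "(norm (u t))\<^sup>2 \<le> exp ((2 * L + 1) * t) * ((norm (u 0))\<^sup>2 + \<epsilon>\<^sup>2)"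
proof -
  define C where "C = 2 * L + 1"
  define w where "w s = exp (- C * s) * (u s \<bullet> u s + \<epsilon>\<^sup>2)" for s
  define w' where "w' s = exp (- C * s) * (2 * (u s \<bullet> u' s) - C * (u s \<bullet> u s + \<epsilon>\<^sup>2))" for s
  have w: "(w has_real_derivative w' s) (at s within {0..t})" if "s \<in> {0..t}" for s
  proof -
    have "((\<lambda>s. u s \<bullet> u s) has_real_derivative 2 * (u s \<bullet> u' s)) (at s within {0..t})"
      using has_derivative_inner[OF d[OF that, unfolded has_vector_derivative_def]
          d[OF that, unfolded has_vector_derivative_def]]
      by (simp add: has_field_derivative_def inner_commute mult_commute_abs algebra_simps)
    then show ?thesis
      unfolding w_def w'_def by (auto intro!: derivative_eq_intros simp: algebra_simps)
  qed
  have "w' s \<le> 0" if "s \<in> {0..t}" for s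
  proof -
    have "u s \<bullet> u' s \<le> norm (u s) * norm (u' s)" by (rule norm_cauchy_schwarz)
    also have "\<dots> \<le> norm (u s) * (L * norm (u s) + \<epsilon>)" by (intro mult_left_mono b that) simp
    finally have 1: "2 * (u s \<bullet> u' s) \<le> 2 * L * (norm (u s))\<^sup>2 + 2 * \<epsilon> * norm (u s)"
      by (simp add: power2_eq_square algebra_simps)
    have "2 * \<epsilon> * norm (u s) \<le> (norm (u s))\<^sup>2 + \<epsilon>\<^sup>2"
      using sum_squares_bound[of \<epsilon> "norm (u s)"] by simp
    then have "2 * (u s \<bullet> u' s) \<le> C * (norm (u s))\<^sup>2 + 1 * \<epsilon>\<^sup>2"
      using 1 unfolding C_def by (simp add: algebra_simps)
    also have "\<dots> \<le> C * (norm (u s))\<^sup>2 + C * \<epsilon>\<^sup>2"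
      by (intro add_left_mono mult_right_mono) (use L C_def in auto)
    finally show ?thesis
      unfolding w'_def
      by (intro mult_nonneg_nonpos) (auto simp: power2_norm_eq_inner[symmetric] algebra_simps)
  qed
  moreover have "(w has_real_derivative w' s) (at s)" if "0 < s" "s < t" for s
    using w[of s] that by (simp add: at_within_Icc_at)
  moreover have "continuous_on {0..t} w"
    using w by (meson DERIV_continuous_on)
  ultimately have "w t \<le> w 0"
    by (intro DERIV_nonpos_imp_decreasing_open[OF t]) force+
  then have "exp (C * t) * w t \<le> exp (C * t) * w 0" by simp
  then have "u t \<bullet> u t + \<epsilon>\<^sup>2 \<le> exp (C * t) * (u 0 \<bullet> u 0 + \<epsilon>\<^sup>2)"
    by (simp add: w_def mult.assoc[symmetric] exp_add[symmetric])
  then have "(norm (u t))\<^sup>2 + \<epsilon>\<^sup>2 \<le> exp (C * t) * ((norm (u 0))\<^sup>2 + \<epsilon>\<^sup>2)"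
    by (simp add: power2_norm_eq_inner)
  then show ?thesis using zero_le_power2[of \<epsilon>] unfolding C_def by linarith
qed

lemma gronwall:
  fixes u :: "real \<Rightarrow> 'a::real_inner"
  assumes S: "is_interval S" "0 \<in> S" "t \<in> S"
    and d: "\<And>s. s \<in> S \<Longrightarrow> (u has_vector_derivative u' s) (at s within S)"
    and b: "\<And>s. s \<in> S \<Longrightarrow> \<bar>s\<bar> \<le> \<bar>t\<bar> \<Longrightarrow> norm (u' s) \<le> L * norm (u s) + \<epsilon>"
    and L: "L \<ge> 0" and \<epsilon>: "\<epsilon> \<ge> 0"
  shows "(norm (u t))\<^sup>2 \<le> exp ((2 * L + 1) * \<bar>t\<bar>) * ((norm (u 0))\<^sup>2 + \<epsilon>\<^sup>2)"
proof (cases "t \<ge> 0")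
  case True
  then have sub: "{0..t} \<subseteq> S" using S by (meson atLeastAtMost_iff mem_is_interval_1_I subsetI)
  have "(norm (u t))\<^sup>2 \<le> exp ((2 * L + 1) * t) * ((norm (u 0))\<^sup>2 + \<epsilon>\<^sup>2)"
  proof (rule gronwall_forward[OF True _ _ L \<epsilon>])
    fix s assume s: "s \<in> {0..t}"
    show "(u has_vector_derivative u' s) (at s within {0..t})"
      using d sub s by (meson has_vector_derivative_within_subset subsetD)
    show "norm (u' s) \<le> L * norm (u s) + \<epsilon>" using b sub s by auto
  qed
  with True show ?thesis by simp
next
  case False
  then have sub: "uminus ` {0..-t} \<subseteq> S"
    using S by (auto intro!: mem_is_interval_1_I[of S t 0])
  have "((\<lambda>s. u (- s)) has_vector_derivative - u' (- s)) (at s within {0..-t})" if "s \<in> {0..-t}" for s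
  proof -
    have "(u has_vector_derivative u' (- s)) (at (- s) within uminus ` {0..-t})"
      using sub that by (intro has_vector_derivative_within_subset[OF d]) auto
    moreover have "(uminus has_vector_derivative - 1) (at s within {0..-t})"
      by (auto intro!: derivative_eq_intros)
    ultimately show ?thesis
      using vector_diff_chain_within[of uminus "-1" s "{0..-t}" u "u' (- s)"] by (simp add: o_def)
  qed
  moreover have "norm (- u' (- s)) \<le> L * norm (u (- s)) + \<epsilon>" if "s \<in> {0..-t}" for s
  proof -
    have "- s \<in> S" using sub that by blast
    then show ?thesis using b[of "- s"] that by auto
  qed
  ultimately have "(norm (u (- (- t))))\<^sup>2 \<le> exp ((2 * L + 1) * (- t)) * ((norm (u (- 0)))\<^sup>2 + \<epsilon>\<^sup>2)"
    using False by (intro gronwall_forward[where u = "\<lambda>s. u (- s)", OF _ _ _ L \<epsilon>]) auto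
  with False show ?thesis by simp
qed

lemma lipschitz_ode_unique:
  fixes y z :: "real \<Rightarrow> 'a::real_inner"
  assumes S: "is_interval S" "0 \<in> S" "t \<in> S"
    and y: "\<And>s. s \<in> S \<Longrightarrow> (y has_vector_derivative G s (y s)) (at s within S)"
    and z: "\<And>s. s \<in> S \<Longrightarrow> (z has_vector_derivative G s (z s)) (at s within S)"
    and lip: "\<And>s. s \<in> S \<Longrightarrow> \<bar>s\<bar> \<le> \<bar>t\<bar> \<Longrightarrow> norm (G s (y s) - G s (z s)) \<le> L * norm (y s - z s)"
    and L: "L \<ge> 0" and init: "y 0 = z 0"
  shows "y t = z t"
proof -
  have "(norm (y t - z t))\<^sup>2 \<le> exp ((2 * L + 1) * \<bar>t\<bar>) * ((norm (y 0 - z 0))\<^sup>2 + 0\<^sup>2)"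
    by (rule gronwall[OF S, where u' = "\<lambda>s. G s (y s) - G s (z s)"])
      (use y z lip L in \<open>auto intro!: has_vector_derivative_diff\<close>)
  then show ?thesis using init by simp
qed

text \<open>The integral of \<open>K exp (2 K |s|)\<close> between 0 and \<open>t\<close> is less than half of the weight \<open>exp (2 K |t|)\<close>;
  this factor 1/2 makes the Picard operator a contraction in the weighted norm below, whatever the
  length of the interval.\<close>

lemma exp_weighted_primitive_bound:
  fixes h :: "real \<Rightarrow> 'a::real_normed_vector"
  assumes h0: "h 0 = 0" and K: "K > 0" and t: "t \<in> {-T..T}"
    and h: "\<And>s. s \<in> {-T..T} \<Longrightarrow> (h has_vector_derivative h' s) (at s within {-T..T})"
    and b: "\<And>s. s \<in> {-T..T} \<Longrightarrow> norm (h' s) \<le> K * exp (2 * K * \<bar>s\<bar>) * D"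
    and D: "D \<ge> 0"
  shows "norm (h t) \<le> exp (2 * K * \<bar>t\<bar>) * (D / 2)"
proof -
  have h_at: "(h has_vector_derivative h' s) (at s)" if "-T < s" "s < T" for s
    using h[of s] that by (simp add: at_within_Icc_at)
  have cont: "continuous_on {-T..T} h"
    using h has_vector_derivative_continuous continuous_on_eq_continuous_within by blast
  consider "t = 0" | "t > 0" | "t < 0" by linarith
  then show ?thesis
  proof cases
    case 1
    then show ?thesis using D h0 by simp
  next
    case 2
    have "norm (h t - h 0) \<le> D / 2 * exp (2 * K * t) - D / 2 * exp (2 * K * 0)"
    proof (rule differentiable_bound_general[OF 2])
      show "continuous_on {0..t} h" by (rule continuous_on_subset[OF cont]) (use 2 t in auto)
      show "continuous_on {0..t} (\<lambda>s. D / 2 * exp (2 * K * s))" by (intro continuous_intros)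
      show "((\<lambda>s. D / 2 * exp (2 * K * s)) has_vector_derivative K * exp (2 * K * s) * D) (at s)" for s
        unfolding has_real_derivative_iff_has_vector_derivative[symmetric]
        by (auto intro!: derivative_eq_intros)
      show "(h has_vector_derivative h' s) (at s)" if "0 < s" "s < t" for s
        using that t by (intro h_at) auto
      show "norm (h' s) \<le> K * exp (2 * K * s) * D" if "0 < s" "s < t" for s
        using b[of s] that t by auto
    qed
    then show ?thesis using 2 h0 D by (simp add: algebra_simps)
  next
    case 3
    have "norm (h 0 - h t) \<le> - D / 2 * exp (- 2 * K * 0) - (- D / 2 * exp (- 2 * K * t))"
    proof (rule differentiable_bound_general[OF 3])
      show "continuous_on {t..0} h" by (rule continuous_on_subset[OF cont]) (use 3 t in auto)
      show "continuous_on {t..0} (\<lambda>s. - D / 2 * exp (- 2 * K * s))" by (intro continuous_intros)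
      show "((\<lambda>s. - D / 2 * exp (- 2 * K * s)) has_vector_derivative K * exp (- 2 * K * s) * D) (at s)" for s
        unfolding has_real_derivative_iff_has_vector_derivative[symmetric]
        by (auto intro!: derivative_eq_intros)
      show "(h has_vector_derivative h' s) (at s)" if "t < s" "s < 0" for s
        using that t by (intro h_at) auto
      show "norm (h' s) \<le> K * exp (- 2 * K * s) * D" if "t < s" "s < 0" for s
        using b[of s] that t by auto
    qed
    then show ?thesis using 3 h0 D by (simp add: algebra_simps)
  qed
qed

text \<open>Global existence for a right-hand side that is Lipschitz in space, uniformly in time. The
  fixed point argument takes place in the bounded continuous functions on the whole line.\<close>

lemma picard_lindelof_compact:
  fixes G :: "real \<Rightarrow> 'a::banach \<Rightarrow> 'a"
  assumes T: "T > 0"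
    and cont: "\<And>X. continuous_on {-T..T} X \<Longrightarrow> continuous_on {-T..T} (\<lambda>t. G t (X t))"
    and lip: "\<And>t x y. t \<in> {-T..T} \<Longrightarrow> norm (G t x - G t y) \<le> L * norm (x - y)"
  obtains X where "X 0 = x\<^sub>0"
    and "\<And>t. t \<in> {-T..T} \<Longrightarrow> (X has_vector_derivative G t (X t)) (at t within {-T..T})"
proof -
  define K where "K = \<bar>L\<bar> + 1"
  have K: "K > 0" by (simp add: K_def)
  have lipK: "norm (G t x - G t y) \<le> K * norm (x - y)" if "t \<in> {-T..T}" for t x y
  proof -
    have "L * norm (x - y) \<le> K * norm (x - y)" by (intro mult_right_mono) (auto simp: K_def)
    with lip[OF that, of x y] show ?thesis by linarith
  qed
  \<comment> \<open>primitive vanishing at time 0, valid on both sides of 0\<close>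
  define I where "I v t = integral {-T..t} v - integral {-T..0} v" for v :: "real \<Rightarrow> 'a" and t
  have I: "(I v has_vector_derivative v t) (at t within {-T..T})"
    if "continuous_on {-T..T} v" "t \<in> {-T..T}" for v t
    unfolding I_def using integral_has_vector_derivative[OF that]
    by (auto intro!: derivative_eq_intros)
  have I0: "I v 0 = 0" for v by (simp add: I_def)
  define c where "c t = max (-T) (min T t)" for t
  have c: "c t \<in> {-T..T}" for t using T by (auto simp: c_def)
  have c_id: "c t = t" if "t \<in> {-T..T}" for t using that by (auto simp: c_def)
  \<comment> \<open>\<open>E Y\<close> is the candidate solution and \<open>Y\<close> its quotient by the weight, so the sup norm of \<open>Y\<close> is the
     weighted norm of the solution; the clamp \<open>c\<close> makes functions on \<open>[-T, T]\<close> bounded functions on the line.\<close>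
  define E where "E Y s = exp (2 * K * \<bar>s\<bar>) *\<^sub>R apply_bcontfun Y s" for Y :: "real \<Rightarrow>\<^sub>C 'a" and s
  have E: "continuous_on S (E Y)" for S Y
    unfolding E_def by (intro continuous_intros) auto
  define Q where "Q Y t = exp (- (2 * K * \<bar>t\<bar>)) *\<^sub>R (x\<^sub>0 + I (\<lambda>s. G s (E Y s)) t)" for Y t
  define P where "P Y = Bcontfun (\<lambda>t. Q Y (c t))" for Y
  have P: "apply_bcontfun (P Y) t = Q Y (c t)" for Y t
  proof -
    have "continuous_on {-T..T} (I (\<lambda>s. G s (E Y s)))"
      using I[OF cont[OF E]] has_vector_derivative_continuous continuous_on_eq_continuous_within
      by blast
    then have Q: "continuous_on {-T..T} (Q Y)"
      unfolding Q_def by (intro continuous_intros)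
    moreover have "continuous_on UNIV c" unfolding c_def by (intro continuous_intros)
    ultimately have "continuous_on UNIV (\<lambda>t. Q Y (c t))"
      using c by (auto intro: continuous_on_compose2)
    moreover have "bounded (range (\<lambda>t. Q Y (c t)))"
      by (rule bounded_subset[OF compact_imp_bounded[OF compact_continuous_image[OF Q]]])
        (use c in auto)
    ultimately show ?thesis
      unfolding P_def by (subst Bcontfun_inverse) (auto simp: bcontfun_def)
  qed
  have "dist (P Y) (P Z) \<le> 1 / 2 * dist Y Z" for Y Z
  proof (rule dist_bound)
    fix t
    define h where "h t = I (\<lambda>s. G s (E Y s)) t - I (\<lambda>s. G s (E Z s)) t" for t
    have "norm (h (c t)) \<le> exp (2 * K * \<bar>c t\<bar>) * (dist Y Z / 2)"
    proof (rule exp_weighted_primitive_bound[OF _ K c])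
      show "h 0 = 0" by (simp add: h_def I0)
      fix s assume s: "s \<in> {-T..T}"
      show "(h has_vector_derivative G s (E Y s) - G s (E Z s)) (at s within {-T..T})"
        unfolding h_def by (intro has_vector_derivative_diff I cont E s)
      have "norm (G s (E Y s) - G s (E Z s)) \<le> K * norm (E Y s - E Z s)" by (rule lipK[OF s])
      also have "norm (E Y s - E Z s) = exp (2 * K * \<bar>s\<bar>) * dist (Y s) (Z s)"
        by (simp add: E_def dist_norm scaleR_diff_right[symmetric])
      also have "K * \<dots> \<le> K * (exp (2 * K * \<bar>s\<bar>) * dist Y Z)"
        by (intro mult_left_mono dist_bounded) (use K in auto)
      finally show "norm (G s (E Y s) - G s (E Z s)) \<le> K * exp (2 * K * \<bar>s\<bar>) * dist Y Z"
        by (simp add: mult.assoc)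
    qed simp
    then have "exp (- (2 * K * \<bar>c t\<bar>)) * norm (h (c t))
        \<le> exp (- (2 * K * \<bar>c t\<bar>)) * (exp (2 * K * \<bar>c t\<bar>) * (dist Y Z / 2))"
      by (intro mult_left_mono) auto
    also have "\<dots> = 1 / 2 * dist Y Z" by (simp add: exp_minus)
    finally show "dist (P Y t) (P Z t) \<le> 1 / 2 * dist Y Z"
      by (simp add: P Q_def dist_norm h_def scaleR_diff_right[symmetric] del: scaleR_scaleR)
  qed
  then obtain Y where Y: "P Y = Y" using banach_fix_type[of "1 / 2" P] by auto
  have EY: "E Y t = x\<^sub>0 + I (\<lambda>s. G s (E Y s)) t" if "t \<in> {-T..T}" for t
  proof -
    have "Y t = Q Y t" using P[of Y t] Y c_id[OF that] by simp
    then show ?thesis unfolding E_def[of Y t] Q_def by (simp add: exp_minus)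
  qed
  show thesis
  proof
    show "E Y 0 = x\<^sub>0" using EY[of 0] T by (simp add: I0)
    fix t assume t: "t \<in> {-T..T}"
    have "((\<lambda>t. x\<^sub>0 + I (\<lambda>s. G s (E Y s)) t) has_vector_derivative 0 + G t (E Y t)) (at t within {-T..T})"
      by (intro has_vector_derivative_add has_vector_derivative_const I cont E t)
    then show "(E Y has_vector_derivative G t (E Y t)) (at t within {-T..T})"
      using EY t by (auto intro: has_vector_derivative_transform)
  qed
qed

section \<open>Flow and variational equation\<close>

lemma smooth_deriv_bounded:
  assumes "smooth f" "compact S"
  obtains M where "M \<ge> 0" "\<And>x. x \<in> S \<Longrightarrow> norm (blinfun_deriv f x) \<le> M"
proof -
  have "bounded (blinfun_deriv f ` S)"
    by (intro compact_imp_bounded compact_continuous_image continuous_on_blinfun_deriv assms)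
  then obtain M where "\<And>x. x \<in> S \<Longrightarrow> norm (blinfun_deriv f x) \<le> M"
    by (auto simp: bounded_iff)
  then show thesis by (intro that[of "max 0 M"]) (auto simp: le_max_iff_disj)
qed

lemma smooth_lipschitz_compact_convex:
  assumes f: "smooth f" and S: "compact S" "convex S"
  obtains L where "L \<ge> 0" "\<And>x y. x \<in> S \<Longrightarrow> y \<in> S \<Longrightarrow> norm (f x - f y) \<le> L * norm (x - y)"
proof -
  obtain L where L: "L \<ge> 0" "\<And>x. x \<in> S \<Longrightarrow> norm (blinfun_deriv f x) \<le> L"
    by (rule smooth_deriv_bounded[OF f S(1)]) blast
  show thesis
    by (rule that[OF L(1)], rule differentiable_bound[OF S(2) has_derivative_blinfun_deriv[OF f]])
      (use L(2) in \<open>simp_all add: norm_blinfun.rep_eq\<close>)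
qed

lemma smooth_uniform_linearization:
  assumes f: "smooth f" and S: "compact S" "convex S" and \<epsilon>: "\<epsilon> > 0"
  obtains \<delta> where "\<delta> > 0" "\<And>x y. x \<in> S \<Longrightarrow> y \<in> S \<Longrightarrow> norm (x - y) < \<delta> \<Longrightarrow>
    norm (f x - f y - blinfun_deriv f y (x - y)) \<le> \<epsilon> * norm (x - y)"
proof -
  have "uniformly_continuous_on S (blinfun_deriv f)"
    by (intro compact_uniformly_continuous continuous_on_blinfun_deriv f S)
  then obtain \<delta> where \<delta>: "\<delta> > 0"
    "\<And>x y. x \<in> S \<Longrightarrow> y \<in> S \<Longrightarrow> dist x y < \<delta> \<Longrightarrow> dist (blinfun_deriv f x) (blinfun_deriv f y) < \<epsilon>"
    using \<epsilon> unfolding uniformly_continuous_on_def by metis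
  show thesis
  proof (rule that[OF \<delta>(1)])
    fix x y assume xy: "x \<in> S" "y \<in> S" "norm (x - y) < \<delta>"
    have "norm (f x - f y - blinfun_deriv f y (x - y)) \<le> norm (x - y) * \<epsilon>"
    proof (rule differentiable_bound_linearization[where S = "closed_segment y x"])
      show "y + t *\<^sub>R (x - y) \<in> closed_segment y x" if "t \<in> {0..1}" for t
        using that unfolding closed_segment_def
        by (intro CollectI exI[of _ t]) (auto simp: algebra_simps)
      show "(f has_derivative blinfun_deriv f z) (at z within closed_segment y x)" for z
        by (rule has_derivative_blinfun_deriv[OF f])
      show "onorm (blinfun_apply (blinfun_deriv f z) - blinfun_apply (blinfun_deriv f y)) \<le> \<epsilon>"
        if z: "z \<in> closed_segment y x" for z
      proof -
        have "z \<in> S" using z xy S(2) closed_segment_subset by blast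
        moreover have "dist z y \<le> norm (x - y)"
          using segment_bound1[OF z] by (simp add: dist_norm)
        ultimately have "dist (blinfun_deriv f z) (blinfun_deriv f y) < \<epsilon>"
          using \<delta>(2) xy by (smt (verit))
        then show ?thesis
          by (simp add: dist_norm norm_blinfun.rep_eq minus_blinfun.rep_eq fun_diff_def)
      qed
    qed simp
    then show "norm (f x - f y - blinfun_deriv f y (x - y)) \<le> \<epsilon> * norm (x - y)"
      by (simp add: mult.commute)
  qed
qed

text \<open>Two solutions stay in a common ball on the compact segment between 0 and \<open>t\<close>, where the
  vector field is Lipschitz.\<close>

lemma smooth_ode_unique:
  assumes f: "smooth f" and S: "is_interval S" "0 \<in> S" "t \<in> S"
    and y: "\<And>s. s \<in> S \<Longrightarrow> (y has_vector_derivative f (y s)) (at s within S)"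
    and z: "\<And>s. s \<in> S \<Longrightarrow> (z has_vector_derivative f (z s)) (at s within S)"
    and init: "y 0 = z 0"
  shows "y t = z t"
proof -
  define I where "I = {min 0 t..max 0 t}"
  have I: "compact I" "is_interval I" "0 \<in> I" "t \<in> I"
    by (auto simp: I_def is_interval_cc)
  have IS: "I \<subseteq> S"
  proof
    fix s assume "s \<in> I"
    then have "min 0 t \<le> s" "s \<le> max 0 t" by (auto simp: I_def)
    moreover have "min 0 t \<in> S" "max 0 t \<in> S" using S by (auto simp: min_def max_def)
    ultimately show "s \<in> S" using mem_is_interval_1_I[OF S(1)] by blast
  qed
  have der: "\<And>s. s \<in> I \<Longrightarrow> (y has_vector_derivative f (y s)) (at s within I)"
    "\<And>s. s \<in> I \<Longrightarrow> (z has_vector_derivative f (z s)) (at s within I)"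
    using y z IS by (meson has_vector_derivative_within_subset subsetD)+
  then have "continuous_on I y" "continuous_on I z"
    using has_vector_derivative_continuous continuous_on_eq_continuous_within by blast+
  then have "bounded (y ` I \<union> z ` I)"
    using I(1) by (simp add: compact_continuous_image compact_imp_bounded)
  then obtain R where R: "y ` I \<union> z ` I \<subseteq> cball 0 R" using bounded_subset_ballD[of _ 0] ball_subset_cball by (metis subset_trans)
  obtain L where "L \<ge> 0"
    "\<And>u v. u \<in> cball 0 R \<Longrightarrow> v \<in> cball 0 R \<Longrightarrow> norm (f u - f v) \<le> L * norm (u - v)"
    by (rule smooth_lipschitz_compact_convex[OF f compact_cball[of 0 R] convex_cball]) blast
  then show ?thesis
    using R by (intro lipschitz_ode_unique[OF I(2-4) der(1) der(2) _ _ init]) blast+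
qed

lemma flow_eq_solution:
  assumes f: "smooth f" and sol: "ivp_solution f x S y" "t \<in> S"
  shows "flow f t x = y t"
  unfolding flow_def
proof (rule the_equality)
  show "\<exists>T z. ivp_solution f x T z \<and> t \<in> T \<and> y t = z t" using sol by blast
  fix u assume "\<exists>T z. ivp_solution f x T z \<and> t \<in> T \<and> u = z t"
  then obtain T z where z: "ivp_solution f x T z" "t \<in> T" "u = z t" by blast
  have "z t = y t"
  proof (rule smooth_ode_unique[OF f, where S = "S \<inter> T"])
    show "is_interval (S \<inter> T)" using sol z by (auto simp: ivp_solution_def intro: is_interval_Int)
    show "(z has_vector_derivative f (z s)) (at s within S \<inter> T)" if "s \<in> S \<inter> T" for s
      using that z by (auto simp: ivp_solution_def intro: has_vector_derivative_within_subset)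
    show "(y has_vector_derivative f (y s)) (at s within S \<inter> T)" if "s \<in> S \<inter> T" for s
      using that sol by (auto simp: ivp_solution_def intro: has_vector_derivative_within_subset)
  qed (use sol z in \<open>auto simp: ivp_solution_def\<close>)
  with z show "u = y t" by simp
qed

lemma gronwall_norm:
  fixes u :: "real \<Rightarrow> 'a::real_inner"
  assumes S: "is_interval S" "0 \<in> S" and T: "\<And>s. s \<in> S \<Longrightarrow> \<bar>s\<bar> \<le> T"
    and u: "\<And>s. s \<in> S \<Longrightarrow> (u has_vector_derivative u' s) (at s within S)"
    and b: "\<And>s. s \<in> S \<Longrightarrow> norm (u' s) \<le> L * norm (u s) + \<epsilon>"
    and L: "L \<ge> 0" and \<epsilon>: "\<epsilon> \<ge> 0" and t: "t \<in> S"
  shows "norm (u t) \<le> sqrt (exp ((2 * L + 1) * T)) * (norm (u 0) + \<epsilon>)"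
proof -
  have "(norm (u t))\<^sup>2 \<le> exp ((2 * L + 1) * \<bar>t\<bar>) * ((norm (u 0))\<^sup>2 + \<epsilon>\<^sup>2)"
    by (rule gronwall[OF S t u b L \<epsilon>])
  also have "\<dots> \<le> exp ((2 * L + 1) * T) * ((norm (u 0) + \<epsilon>)\<^sup>2)"
    using T[OF t] L \<epsilon> by (intro mult_mono) (auto simp: power2_sum)
  finally have "norm (u t) \<le> sqrt (exp ((2 * L + 1) * T) * ((norm (u 0) + \<epsilon>)\<^sup>2))"
    by (rule real_le_rsqrt)
  then show "norm (u t) \<le> sqrt (exp ((2 * L + 1) * T)) * (norm (u 0) + \<epsilon>)"
    using \<epsilon> by (simp add: real_sqrt_mult)
qed

text \<open>Precomposing with the projection onto a ball makes the vector field globally Lipschitz without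
  changing it on the ball. Solutions that stay in the ball are the same for both fields, which reduces
  existence near a given solution to global existence.\<close>

lemma lipschitz_cutoff:
  fixes f :: "'a::euclidean_space \<Rightarrow> 'a"
  assumes f: "smooth f" and R: "R \<ge> 0"
  obtains g L where "L \<ge> 0" "\<And>x. x \<in> cball 0 R \<Longrightarrow> g x = f x"
    "\<And>x y. norm (g x - g y) \<le> L * norm (x - y)"
proof -
  obtain L where L: "L \<ge> 0"
    "\<And>u v. u \<in> cball 0 R \<Longrightarrow> v \<in> cball 0 R \<Longrightarrow> norm (f u - f v) \<le> L * norm (u - v)"
    by (rule smooth_lipschitz_compact_convex[OF f compact_cball[of 0 R] convex_cball]) blast
  define g where "g z = f (closest_point (cball 0 R) z)" for z
  have ne: "cball (0::'a) R \<noteq> {}" using R by simp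
  show thesis
  proof (rule that[OF L(1)])
    show "g x = f x" if "x \<in> cball 0 R" for x using that by (simp add: g_def closest_point_self)
    fix x y
    have "norm (g x - g y) \<le> L * norm (closest_point (cball 0 R) x - closest_point (cball 0 R) y)"
      unfolding g_def by (intro L closest_point_in_set closed_cball ne)
    also have "\<dots> \<le> L * norm (x - y)"
      using closest_point_lipschitz[OF convex_cball closed_cball ne, of x y] L(1)
      by (simp add: dist_norm mult_left_mono)
    finally show "norm (g x - g y) \<le> L * norm (x - y)" .
  qed
qed

lemma continuous_on_interval_enlarge:
  fixes X :: "real \<Rightarrow> 'a::metric_space"
  assumes b: "b \<ge> 0" and X: "continuous_on {-(b+1)..b+1} X" and d: "d > 0"
  obtains e where "0 < e" "e \<le> 1" "\<And>t. t \<in> {-e<..<b+e} \<Longrightarrow> \<exists>t'\<in>{0..b}. dist (X t) (X t') < d"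
proof -
  have "uniformly_continuous_on {-(b+1)..b+1} X"
    by (intro compact_uniformly_continuous X compact_Icc)
  then obtain e0 where e0: "e0 > 0"
    "\<And>t t'. t \<in> {-(b+1)..b+1} \<Longrightarrow> t' \<in> {-(b+1)..b+1} \<Longrightarrow> dist t t' < e0 \<Longrightarrow> dist (X t) (X t') < d"
    using d unfolding uniformly_continuous_on_def by metis
  show thesis
  proof (rule that[of "min e0 1"])
    fix t assume t: "t \<in> {- min e0 1<..<b + min e0 1}"
    have "max 0 (min b t) \<in> {0..b}" using b by auto
    moreover have "dist (X t) (X (max 0 (min b t))) < d"
      using t b e0(1) by (intro e0(2)) (auto simp: dist_real_def max_def min_def split: if_splits)
    ultimately show "\<exists>t'\<in>{0..b}. dist (X t) (X t') < d" by blast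
  qed (use e0 in auto)
qed

text \<open>If the solution from \<open>x\<close> reaches time \<open>b\<close>, then the flow is defined near \<open>[0, b]\<close> for all nearby initial
  values, and its space derivative \<open>W\<close> solves the variational equation. With \<open>b = 0\<close> this is the local theory
  at an arbitrary point.

  The solutions \<open>X z\<close> of the cut-off equation exist on all of \<open>[-(b+1), b+1]\<close> and depend on \<open>z\<close> in a Lipschitz
  way, so for \<open>z\<close> near \<open>x\<close> they stay in the ball and are flow lines of \<open>f\<close>. The difference
  \<open>X z s - X x s - W s (z - x)\<close> satisfies the variational equation up to the linearization error of \<open>f\<close>,
  which is \<open>o(|z - x|)\<close> uniformly in time; Gronwall transfers this to the difference itself.\<close>

lemma flow_variational:
  fixes f :: "'a::euclidean_space \<Rightarrow> 'a"
  assumes f: "smooth f" and b: "b \<ge> 0" and ex: "b \<in> existence_ivl f x"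
  obtains e W where "e > 0" "flow f 0 x = x" "W 0 = id_blinfun"
    and "\<And>t. t \<in> {-e<..<b+e} \<Longrightarrow> ((\<lambda>s. flow f s x) has_vector_derivative f (flow f t x)) (at t)"
    and "\<And>t. t \<in> {-e<..<b+e} \<Longrightarrow> (flow f t has_derivative blinfun_apply (W t)) (at x)"
    and "\<And>t. t \<in> {-e<..<b+e} \<Longrightarrow>
      (W has_vector_derivative blinfun_deriv f (flow f t x) o\<^sub>L W t) (at t)"
proof -
  obtain S y where sol: "ivp_solution f x S y" "b \<in> S"
    using ex unfolding existence_ivl_def by blast
  have sub: "{0..b} \<subseteq> S"
    using sol mem_is_interval_1_I[of S 0 b] by (auto simp: ivp_solution_def)
  have y: "(y has_vector_derivative f (y t)) (at t within {0..b})" if "t \<in> {0..b}" for t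
    using sol sub that by (meson has_vector_derivative_within_subset ivp_solution_def subsetD)
  have y0: "y 0 = x" using sol by (simp add: ivp_solution_def)
  have "continuous_on {0..b} y"
    using y has_vector_derivative_continuous continuous_on_eq_continuous_within by blast
  then have "bounded (y ` {0..b})" by (simp add: compact_continuous_image compact_imp_bounded)
  then obtain r where r: "\<And>t. t \<in> {0..b} \<Longrightarrow> norm (y t) \<le> r"
    unfolding bounded_iff by blast
  define R where "R = r + 1"
  have r0: "r \<ge> 0" using order_trans[OF norm_ge_zero r[of 0]] b by simp
  then have R: "R \<ge> 0" by (simp add: R_def)
  obtain g L where g: "L \<ge> 0" "\<And>x. x \<in> cball 0 R \<Longrightarrow> g x = f x"
    "\<And>x y. norm (g x - g y) \<le> L * norm (x - y)"
    by (rule lipschitz_cutoff[OF f R]) blast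
  have cont_g: "continuous_on UNIV g"
    by (rule lipschitz_on_continuous_on[of L]) (use g in \<open>simp add: lipschitz_on_def dist_norm\<close>)
  define T where "T = b + 1"
  define I where "I = {-T..T}"
  have T: "T > 0" using b by (simp add: T_def)
  have I: "is_interval I" "0 \<in> I" "\<And>s. s \<in> I \<Longrightarrow> \<bar>s\<bar> \<le> T" "compact I"
    using T by (auto simp: I_def is_interval_cc)
  have "\<exists>X. X 0 = z \<and> (\<forall>t\<in>I. (X has_vector_derivative g (X t)) (at t within I))" for z
    unfolding I_def
    by (rule picard_lindelof_compact[OF T, of "\<lambda>_. g" L z])
      (use g cont_g in \<open>auto intro: continuous_on_compose2\<close>)
  then obtain X where X0: "\<And>z. X z 0 = z"
    and X: "\<And>z t. t \<in> I \<Longrightarrow> (X z has_vector_derivative g (X z t)) (at t within I)" by metis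
  have Xy: "X x t = y t" if t: "t \<in> {0..b}" for t
  proof (rule lipschitz_ode_unique[where S = "{0..b}" and G = "\<lambda>_. g" and L = L])
    fix s assume s: "s \<in> {0..b}"
    have sub: "{0..b} \<subseteq> I" by (auto simp: I_def T_def)
    show "(X x has_vector_derivative g (X x s)) (at s within {0..b})"
      using X sub s by (meson has_vector_derivative_within_subset subsetD)
    have "norm (y s) \<le> R" using r[OF s] by (simp add: R_def)
    then show "(y has_vector_derivative g (y s)) (at s within {0..b})"
      using y[OF s] g(2)[of "y s"] by simp
  qed (use t g X0 y0 in \<open>auto simp: is_interval_cc\<close>)
  have cont_X: "continuous_on I (X z)" for z
    using X has_vector_derivative_continuous continuous_on_eq_continuous_within by blast
  obtain e where e: "0 < e" "e \<le> 1"
    and near: "\<And>t. t \<in> {-e<..<b+e} \<Longrightarrow> \<exists>t'\<in>{0..b}. dist (X x t) (X x t') < 1 / 2"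
    by (rule continuous_on_interval_enlarge[OF b, of "X x" "1 / 2"])
      (use cont_X in \<open>auto simp: I_def T_def\<close>)
  define J where "J = {-e<..<b+e}"
  have J: "is_interval J" "0 \<in> J" "\<And>s. s \<in> J \<Longrightarrow> \<bar>s\<bar> \<le> T" "J \<subseteq> I" "open J"
    using e b by (auto simp: J_def I_def T_def is_interval_oo)
  have Xx_bound: "norm (X x t) < r + 1 / 2" if t: "t \<in> J" for t
  proof -
    obtain t' where t': "t' \<in> {0..b}" "dist (X x t) (X x t') < 1 / 2" using near t J_def by blast
    have "norm (X x t) \<le> norm (X x t') + dist (X x t) (X x t')"
      by (metis add.commute dist_norm norm_triangle_sub)
    with t' r[of t'] Xy[of t'] show ?thesis by simp
  qed
  define K where "K = sqrt (exp ((2 * L + 1) * T))"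
  have K: "K > 0" by (simp add: K_def)
  have XK: "norm (X z t - X x t) \<le> K * norm (z - x)" if "t \<in> I" for z t
  proof -
    have "norm (X z t - X x t) \<le> sqrt (exp ((2 * L + 1) * T)) * (norm (X z 0 - X x 0) + 0)"
    proof (rule gronwall_norm[OF I(1-3) _ _ g(1) order_refl that])
      fix s assume s: "s \<in> I"
      show "((\<lambda>s. X z s - X x s) has_vector_derivative g (X z s) - g (X x s)) (at s within I)"
        by (intro has_vector_derivative_diff X s)
      show "norm (g (X z s) - g (X x s)) \<le> L * norm (X z s - X x s) + 0" using g(3) by simp
    qed
    then show ?thesis by (simp add: K_def X0)
  qed
  \<comment> \<open>within distance \<open>d\<close> of \<open>x\<close>, trajectories deviate by less than the margin 1/2 left in \<open>Xx_bound\<close>\<close>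
  define d where "d = 1 / (2 * K)"
  have d: "d > 0" using K by (simp add: d_def)
  have X_ball: "X z t \<in> cball 0 R" if "t \<in> J" "norm (z - x) < d" for z t
  proof -
    have "K * norm (z - x) < 1 / 2" using that(2) K by (simp add: d_def field_simps)
    then have "norm (X z t - X x t) < 1 / 2" using XK[of t z] that J(4) by force
    moreover have "norm (X z t) \<le> norm (X x t) + norm (X z t - X x t)"
      by (rule norm_triangle_sub)
    ultimately show ?thesis using Xx_bound[OF that(1)] by (simp add: R_def)
  qed
  have Xf: "(X z has_vector_derivative f (X z t)) (at t)" if "t \<in> J" "norm (z - x) < d" for z t
  proof -
    have "(X z has_vector_derivative g (X z t)) (at t within J)"
      using X J(4) that(1) by (meson has_vector_derivative_within_subset subsetD)
    then show ?thesis using g(2)[OF X_ball[OF that]] at_within_open[OF that(1) J(5)] by simp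
  qed
  have flow: "flow f t z = X z t" if "t \<in> J" "norm (z - x) < d" for z t
  proof (rule flow_eq_solution[OF f _ that(1)])
    show "ivp_solution f z J (X z)"
      unfolding ivp_solution_def using J(1,2) X0 has_vector_derivative_at_within[OF Xf[OF _ that(2)]]
      by blast
  qed
  have flow_x: "flow f t x = X x t" if "t \<in> J" for t using flow[OF that, of x] d by simp
  obtain M where M: "M \<ge> 0" "\<And>t. t \<in> I \<Longrightarrow> norm (blinfun_deriv f (X x t)) \<le> M"
    by (rule smooth_deriv_bounded[OF f compact_continuous_image[OF cont_X I(4)]]) blast
  define A where "A t = blinfun_deriv f (X x t)" for t
  have cont_A: "continuous_on I A"
    unfolding A_def
    by (rule continuous_on_compose2[OF continuous_on_blinfun_deriv[OF f] cont_X]) auto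
  obtain W where W0: "W 0 = id_blinfun"
    and W: "\<And>t. t \<in> I \<Longrightarrow> (W has_vector_derivative A t o\<^sub>L W t) (at t within I)"
    unfolding I_def
  proof (rule picard_lindelof_compact[OF T, of "\<lambda>t V. A t o\<^sub>L V" M id_blinfun])
    show "continuous_on {- T..T} (\<lambda>t. A t o\<^sub>L V t)" if "continuous_on {- T..T} V"
      for V :: "real \<Rightarrow> 'a \<Rightarrow>\<^sub>L 'a"
      using cont_A that unfolding I_def
      by (rule bounded_bilinear.continuous_on[OF bounded_bilinear_blinfun_compose])
    fix t and U V :: "'a \<Rightarrow>\<^sub>L 'a" assume t: "t \<in> {-T..T}"
    have "norm (A t o\<^sub>L (U - V)) \<le> norm (A t) * norm (U - V)" by (rule norm_blinfun_compose)
    also have "\<dots> \<le> M * norm (U - V)"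
      using M(2)[of t] t by (intro mult_right_mono) (auto simp: A_def I_def)
    finally show "norm ((A t o\<^sub>L U) - (A t o\<^sub>L V)) \<le> M * norm (U - V)"
      by (simp add: bounded_bilinear.diff_right[OF bounded_bilinear_blinfun_compose])
  qed blast
  define N where "N = sqrt (exp ((2 * M + 1) * T))"
  have N: "N > 0" by (simp add: N_def)
  have deriv: "(flow f t has_derivative blinfun_apply (W t)) (at x)" if t: "t \<in> J" for t
    unfolding has_derivative_at_alt
  proof (intro conjI allI impI)
    show "bounded_linear (blinfun_apply (W t))" by (rule blinfun.bounded_linear_right)
    fix \<epsilon> :: real assume \<epsilon>: "\<epsilon> > 0"
    \<comment> \<open>compensates the factor \<open>K\<close> of Lipschitz dependence and the factor \<open>N\<close> of Gronwall\<close>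
    define \<epsilon>' where "\<epsilon>' = \<epsilon> / (N * K)"
    have \<epsilon>': "\<epsilon>' > 0" using \<epsilon> N K by (simp add: \<epsilon>'_def)
    obtain \<delta> where \<delta>: "\<delta> > 0" "\<And>u v. u \<in> cball 0 R \<Longrightarrow> v \<in> cball 0 R \<Longrightarrow> norm (u - v) < \<delta> \<Longrightarrow>
      norm (f u - f v - blinfun_deriv f v (u - v)) \<le> \<epsilon>' * norm (u - v)"
      by (rule smooth_uniform_linearization[OF f compact_cball[of 0 R] convex_cball \<epsilon>']) blast
    have "norm (flow f t z - flow f t x - W t (z - x)) \<le> \<epsilon> * norm (z - x)"
      if z: "norm (z - x) < min d (\<delta> / K)" for z
    proof -
      define u where "u s = X z s - X x s - W s (z - x)" for s
      define u' where "u' s = f (X z s) - f (X x s) - A s (W s (z - x))" for s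
      have "norm (u t) \<le> sqrt (exp ((2 * M + 1) * T)) * (norm (u 0) + \<epsilon>' * (K * norm (z - x)))"
      proof (rule gronwall_norm[OF J(1-3) _ _ M(1) _ t])
        fix s assume s: "s \<in> J"
        have "(W has_vector_derivative A s o\<^sub>L W s) (at s within J)"
          using W J(4) s by (meson has_vector_derivative_within_subset subsetD)
        from bounded_linear.has_vector_derivative[OF blinfun.bounded_linear_left this]
        have "((\<lambda>s. W s (z - x)) has_vector_derivative A s (W s (z - x))) (at s within J)"
          by simp
        then show "(u has_vector_derivative u' s) (at s within J)"
          unfolding u_def u'_def using s z d
          by (intro has_vector_derivative_diff has_vector_derivative_at_within[OF Xf]) simp_all
        have zK: "norm (X z s - X x s) \<le> K * norm (z - x)" using XK s J(4) by blast
        also have "\<dots> < \<delta>" using z K by (simp add: field_simps)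
        finally have lin: "norm (f (X z s) - f (X x s) - A s (X z s - X x s))
            \<le> \<epsilon>' * norm (X z s - X x s)"
          unfolding A_def using X_ball[OF s] z d by (intro \<delta>(2)) auto
        have "u' s = (f (X z s) - f (X x s) - A s (X z s - X x s)) + A s (u s)"
          by (simp add: u'_def u_def blinfun.diff_right)
        also have "norm \<dots> \<le> \<epsilon>' * norm (X z s - X x s) + norm (A s) * norm (u s)"
          by (rule norm_triangle_mono[OF lin norm_blinfun])
        also have "\<dots> \<le> \<epsilon>' * (K * norm (z - x)) + M * norm (u s)"
          using M(1) M(2)[of s] s J(4) \<epsilon>' zK by (intro add_mono mult_mono) (auto simp: A_def)
        finally show "norm (u' s) \<le> M * norm (u s) + \<epsilon>' * (K * norm (z - x))" by simp
      qed (use \<epsilon>' K in \<open>auto intro!: mult_nonneg_nonneg\<close>)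
      also have "\<dots> = \<epsilon> * norm (z - x)"
        using N K by (simp add: u_def X0 W0 N_def[symmetric] \<epsilon>'_def)
      finally show ?thesis using flow t z d by (simp add: u_def)
    qed
    then show "\<exists>d>0. \<forall>z. norm (z - x) < d \<longrightarrow>
      norm (flow f t z - flow f t x - W t (z - x)) \<le> \<epsilon> * norm (z - x)"
      using d \<delta>(1) K by (intro exI[of _ "min d (\<delta> / K)"]) auto
  qed
  show thesis
  proof (rule that[OF e(1), folded J_def])
    show "flow f 0 x = x" using flow_x[OF J(2)] X0 by simp
    show "W 0 = id_blinfun" by (rule W0)
    fix t assume t: "t \<in> J"
    show "(flow f t has_derivative blinfun_apply (W t)) (at x)" by (rule deriv[OF t])
    have "(X x has_vector_derivative f (flow f t x)) (at t)"
      using Xf[OF t, of x] d flow_x[OF t] by simp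
    then show "((\<lambda>s. flow f s x) has_vector_derivative f (flow f t x)) (at t)"
      by (rule has_vector_derivative_transform_within_open[OF _ J(5) t]) (simp add: flow_x)
    have "(W has_vector_derivative A t o\<^sub>L W t) (at t within J)"
      using W J(4) t by (meson has_vector_derivative_within_subset subsetD)
    then show "(W has_vector_derivative blinfun_deriv f (flow f t x) o\<^sub>L W t) (at t)"
      using at_within_open[OF t J(5)] by (simp add: A_def flow_x[OF t])
  qed
qed

section \<open>Time derivatives along the flow\<close>

text \<open>Since \<open>F o y\<close> has derivative \<open>lie f F o y\<close> for a solution \<open>y\<close>, the i-th time derivative of a
  solution is the i-th iterated Lie derivative of the identity, evaluated along the solution. The
  derivatives of the variational solution are the Jacobians of these maps, applied to the variational
  solution; this is where symmetry of second derivatives enters.\<close>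

definition lie_iter :: "('a::euclidean_space \<Rightarrow> 'a) \<Rightarrow> nat \<Rightarrow> 'a \<Rightarrow> 'a" where
  "lie_iter f i = (lie f ^^ i) (\<lambda>x. x)"

lemma lie_iter_0 [simp]: "lie_iter f 0 x = x"
  by (simp add: lie_iter_def)

lemma lie_iter_Suc: "lie_iter f (Suc i) = lie f (lie_iter f i)"
  by (simp add: lie_iter_def)

lemma smooth_lie_iter: "smooth f \<Longrightarrow> smooth (lie_iter f i)"
  by (induction i) (simp_all add: lie_iter_Suc smooth_lie, simp add: lie_iter_def smooth_id)

lemma blinfun_deriv_lie_iter_0 [simp]: "blinfun_deriv (lie_iter f 0) x = id_blinfun"
  by (rule blinfun_eqI, subst blinfun_deriv_eq[where f' = "\<lambda>v. v"])
    (auto simp: lie_iter_def smooth_id)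

lemma has_vector_derivative_along_solution:
  assumes F: "smooth F" and y: "(y has_vector_derivative f (y t)) (at t)"
  shows "((\<lambda>s. F (y s)) has_vector_derivative lie f F (y t)) (at t)"
  using has_derivative_compose[OF y[unfolded has_vector_derivative_def] has_derivative_blinfun_deriv[OF F]]
  by (simp add: has_vector_derivative_def lie_def blinfun.scaleR_right)

lemma second_derivative_sum_Basis:
  assumes "smooth F"
  shows "(\<Sum>b\<in>Basis. (w \<bullet> b) *\<^sub>R blinfun_deriv (\<lambda>z. blinfun_deriv F z b) x v)
    = blinfun_deriv (\<lambda>z. blinfun_deriv F z w) x v"
  by (simp add: second_derivative_symmetric[OF assms, of _ x v] blinfun_apply_sum_Basis[symmetric])

text \<open>The product rule produces the second derivative with the derivative of \<open>F\<close> taken in direction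
  \<open>f x\<close> first and in direction \<open>w\<close> second; symmetry brings it into the order that differentiation along a
  solution produces.\<close>

lemma blinfun_deriv_lie:
  assumes f: "smooth f" and F: "smooth F"
  shows "blinfun_deriv (lie f F) x w
    = blinfun_deriv (\<lambda>z. blinfun_deriv F z w) x (f x) + blinfun_deriv F x (blinfun_deriv f x w)"
proof -
  have "(lie f F has_derivative (\<lambda>w. \<Sum>b\<in>Basis. (f x \<bullet> b) *\<^sub>R blinfun_deriv (\<lambda>z. blinfun_deriv F z b) x w
      + (blinfun_deriv f x w \<bullet> b) *\<^sub>R blinfun_deriv F x b)) (at x)"
    unfolding lie_sum_Basis
    by (intro has_derivative_sum has_derivative_scaleR has_derivative_inner_left
        has_derivative_blinfun_deriv f smooth_blinfun_deriv F)
  from blinfun_deriv_eq[OF smooth_lie[OF f F] this]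
  have "blinfun_deriv (lie f F) x w
      = (\<Sum>b\<in>Basis. (f x \<bullet> b) *\<^sub>R blinfun_deriv (\<lambda>z. blinfun_deriv F z b) x w)
      + blinfun_deriv F x (blinfun_deriv f x w)"
    by (simp add: sum.distrib blinfun_apply_sum_Basis[of "blinfun_deriv F x" "blinfun_deriv f x w"])
  then show ?thesis
    by (simp add: second_derivative_sum_Basis[OF F] second_derivative_symmetric[OF F, of "f x"])
qed

text \<open>Time and space derivative commute: differentiating \<open>DF(y) w\<close> in time gives
  \<open>D^2F(y)(f y, w) + DF(y) Df(y) w\<close>, and \<open>blinfun_deriv_lie\<close> finds the same two
  terms in the derivative of the Lie derivative of \<open>F\<close>. Expanding \<open>w\<close> in the basis avoids differentiating
  the operator-valued map \<open>s \<mapsto> DF(y s)\<close>.\<close>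

lemma has_vector_derivative_along_variation:
  assumes f: "smooth f" and F: "smooth F"
    and y: "(y has_vector_derivative f (y t)) (at t)"
    and w: "(w has_vector_derivative blinfun_deriv f (y t) (w t)) (at t)"
  shows "((\<lambda>s. blinfun_deriv F (y s) (w s)) has_vector_derivative
    blinfun_deriv (lie f F) (y t) (w t)) (at t)"
proof -
  have "((\<lambda>s. w s \<bullet> b) has_vector_derivative blinfun_deriv f (y t) (w t) \<bullet> b) (at t)" for b
    by (rule bounded_linear.has_vector_derivative[OF bounded_linear_inner_left w])
  then have "((\<lambda>s. w s \<bullet> b) has_real_derivative blinfun_deriv f (y t) (w t) \<bullet> b) (at t)" for b
    by (simp add: has_real_derivative_iff_has_vector_derivative)
  then have "((\<lambda>s. \<Sum>b\<in>Basis. (w s \<bullet> b) *\<^sub>R blinfun_deriv F (y s) b) has_vector_derivative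
      (\<Sum>b\<in>Basis. (w t \<bullet> b) *\<^sub>R lie f (\<lambda>z. blinfun_deriv F z b) (y t)
        + (blinfun_deriv f (y t) (w t) \<bullet> b) *\<^sub>R blinfun_deriv F (y t) b)) (at t)"
    by (intro has_vector_derivative_sum has_vector_derivative_scaleR
        has_vector_derivative_along_solution[where F = "\<lambda>z. blinfun_deriv F z _"] smooth_blinfun_deriv F y)
  moreover have "(\<Sum>b\<in>Basis. (w t \<bullet> b) *\<^sub>R lie f (\<lambda>z. blinfun_deriv F z b) (y t)
        + (blinfun_deriv f (y t) (w t) \<bullet> b) *\<^sub>R blinfun_deriv F (y t) b)
      = blinfun_deriv (lie f F) (y t) (w t)"
    by (simp add: sum.distrib lie_def second_derivative_sum_Basis[OF F] blinfun_deriv_lie[OF f F]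
        blinfun_apply_sum_Basis[of "blinfun_deriv F (y t)" "blinfun_deriv f (y t) (w t)"])
  ultimately show ?thesis
    by (simp add: blinfun_apply_sum_Basis[of "blinfun_deriv F _" "w _", symmetric])
qed

lemma has_vector_derivative_vec:
  fixes g :: "real \<Rightarrow> 'a::real_normed_vector^'n"
  assumes "\<And>i. ((\<lambda>t. g t $ i) has_vector_derivative g' $ i) F"
  shows "(g has_vector_derivative g') F"
  using assms unfolding has_vector_derivative_def
  by (auto simp: has_derivative_def vec_tendstoI bounded_linear_scaleR_left intro!: vec_tendstoI)

lemma has_vector_derivative_matrix:
  fixes B :: "real \<Rightarrow> real^'n \<Rightarrow> real^'m"
  assumes "\<And>k. ((\<lambda>s. B s (axis k 1)) has_vector_derivative B' (axis k 1)) F"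
  shows "((\<lambda>s. matrix (B s)) has_vector_derivative matrix B') F"
proof (intro has_vector_derivative_vec)
  fix i k
  show "((\<lambda>s. matrix (B s) $ i $ k) has_vector_derivative matrix B' $ i $ k) F"
    unfolding matrix_def
    using bounded_linear.has_vector_derivative[OF bounded_linear_vec_nth assms[of k], of i] by simp
qed

definition lie_jacobian :: "(real^'n \<Rightarrow> real^'n) \<Rightarrow> nat \<Rightarrow> real^'n \<Rightarrow> real^'n^'n" where
  "lie_jacobian f i x = matrix (blinfun_deriv (lie_iter f i) x)"

lemma lie_jacobian_0 [simp]: "lie_jacobian f 0 x = mat 1"
  by (simp add: lie_jacobian_def matrix_id_mat_1 id_def[symmetric] fun_eq_iff)

lemma has_derivative_lie_iter:
  assumes "smooth f"
  shows "(lie_iter f i has_derivative (\<lambda>v. lie_jacobian f i x *v v)) (at x within S)"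
  using has_derivative_blinfun_deriv[OF smooth_lie_iter[OF assms]]
  by (simp add: lie_jacobian_def matrix_vector_mul[symmetric] blinfun.bounded_linear_right)

text \<open>The sequences of time derivatives of the flow and of the variational flow, on a neighbourhood
  of \<open>[0, b]\<close>, in the form in which the Hermite-Obreshkov formula consumes them.\<close>

lemma flow_derivatives:
  fixes f :: "real^'n \<Rightarrow> real^'n"
  assumes f: "smooth f" and b: "b \<ge> 0" and ex: "b \<in> existence_ivl f x"
  obtains e where "e > 0" "flow f 0 x = x" "var_flow f 0 x (mat 1) = mat 1"
    and "\<And>t i. t \<in> {-e<..<b+e} \<Longrightarrow>
      ((\<lambda>s. lie_iter f i (flow f s x)) has_vector_derivative lie_iter f (Suc i) (flow f t x)) (at t)"
    and "\<And>t i. t \<in> {-e<..<b+e} \<Longrightarrow>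
      ((\<lambda>s. lie_jacobian f i (flow f s x) ** var_flow f s x (mat 1)) has_vector_derivative
        lie_jacobian f (Suc i) (flow f t x) ** var_flow f t x (mat 1)) (at t)"
proof -
  obtain e W where e: "e > 0" "flow f 0 x = x" and W0: "W 0 = id_blinfun"
    and flow: "\<And>t. t \<in> {-e<..<b+e} \<Longrightarrow> ((\<lambda>s. flow f s x) has_vector_derivative f (flow f t x)) (at t)"
    and D: "\<And>t. t \<in> {-e<..<b+e} \<Longrightarrow> (flow f t has_derivative blinfun_apply (W t)) (at x)"
    and W: "\<And>t. t \<in> {-e<..<b+e} \<Longrightarrow>
      (W has_vector_derivative blinfun_deriv f (flow f t x) o\<^sub>L W t) (at t)"
    by (rule flow_variational[OF f b ex]) blast
  have var: "var_flow f t x (mat 1) = matrix (W t)" if "t \<in> {-e<..<b+e}" for t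
    using frechet_derivative_at[OF D[OF that]] by (simp add: var_flow_def)
  have jac: "lie_jacobian f i (flow f t x) ** var_flow f t x (mat 1)
      = matrix (\<lambda>v. blinfun_deriv (lie_iter f i) (flow f t x) (W t v))"
    if "t \<in> {-e<..<b+e}" for t i
    using matrix_compose[of "W t" "blinfun_deriv (lie_iter f i) (flow f t x)"]
    by (simp add: var[OF that] lie_jacobian_def o_def blinfun.bounded_linear_right bounded_linear.linear)
  show thesis
  proof (rule that[OF e])
    show "var_flow f 0 x (mat 1) = mat 1"
      using var[of 0] e b W0 by (simp add: matrix_id_mat_1 id_def[symmetric] fun_eq_iff)
    fix t i assume t: "t \<in> {-e<..<b+e}"
    show "((\<lambda>s. lie_iter f i (flow f s x)) has_vector_derivative lie_iter f (Suc i) (flow f t x)) (at t)"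
      unfolding lie_iter_Suc
      by (intro has_vector_derivative_along_solution smooth_lie_iter f flow t)
    have "((\<lambda>s. W s v) has_vector_derivative blinfun_deriv f (flow f t x) (W t v)) (at t)" for v
      using bounded_linear.has_vector_derivative[OF blinfun.bounded_linear_left W[OF t], of v] by simp
    then have "((\<lambda>s. matrix (\<lambda>v. blinfun_deriv (lie_iter f i) (flow f s x) (W s v))) has_vector_derivative
        matrix (\<lambda>v. blinfun_deriv (lie_iter f (Suc i)) (flow f t x) (W t v))) (at t)"
      unfolding lie_iter_Suc
      by (intro has_vector_derivative_matrix has_vector_derivative_along_variation f smooth_lie_iter flow t)
    then show "((\<lambda>s. lie_jacobian f i (flow f s x) ** var_flow f s x (mat 1)) has_vector_derivative
        lie_jacobian f (Suc i) (flow f t x) ** var_flow f t x (mat 1)) (at t)"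
      unfolding jac[OF t]
      by (rule has_vector_derivative_transform_within_open[OF _ open_greaterThanLessThan t])
        (simp only: jac)
  qed
qed

lemma iterated_vector_derivative_eq:
  assumes "open J"
    and "\<And>t i. t \<in> J \<Longrightarrow> (g i has_vector_derivative g (Suc i) t) (at t)"
  shows "t \<in> J \<Longrightarrow> ((\<lambda>u s. vector_derivative u (at s)) ^^ i) (g 0) t = g i t"
proof (induction i arbitrary: t)
  case (Suc i)
  have "(((\<lambda>u s. vector_derivative u (at s)) ^^ i) (g 0) has_vector_derivative g (Suc i) t) (at t)"
    using assms(2)[OF Suc.prems] assms(1) Suc.prems
    by (rule has_vector_derivative_transform_within_open) (simp add: Suc.IH)
  then show ?case by (simp add: vector_derivative_at)
qed simp

text \<open>Taylor coefficients at time 0 only need local existence, so these identities hold at every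
  point. They make both kinds of coefficients explicit, and show that the second kind is the space
  derivative of the first.\<close>

lemma flow_coeff_eq_lie:
  assumes f: "smooth f" shows "flow_coeff f i 0 x = (1 / fact i) *\<^sub>R lie_iter f i x"
    and var_flow_coeff_eq_lie:
      "var_flow_coeff f i 0 x (mat 1) = (1 / fact i) *\<^sub>R lie_jacobian f i x"
proof -
  have "ivp_solution f x {0} (\<lambda>_. x)"
    by (simp add: ivp_solution_def is_interval_1 has_vector_derivative_def has_derivative_within_singleton_iff
        bounded_linear_scaleR_left)
  then have "0 \<in> existence_ivl f x" unfolding existence_ivl_def by blast
  then obtain e where e: "e > 0" "flow f 0 x = x" "var_flow f 0 x (mat 1) = mat 1"
    and 1: "\<And>t i. t \<in> {-e<..<0+e} \<Longrightarrow>
      ((\<lambda>s. lie_iter f i (flow f s x)) has_vector_derivative lie_iter f (Suc i) (flow f t x)) (at t)"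
    and 2: "\<And>t i. t \<in> {-e<..<0+e} \<Longrightarrow>
      ((\<lambda>s. lie_jacobian f i (flow f s x) ** var_flow f s x (mat 1)) has_vector_derivative
        lie_jacobian f (Suc i) (flow f t x) ** var_flow f t x (mat 1)) (at t)"
    by (rule flow_derivatives[OF f order_refl]) blast
  have 0: "0 \<in> {-e<..<0+e}" using e by simp
  show "flow_coeff f i 0 x = (1 / fact i) *\<^sub>R lie_iter f i x"
    using iterated_vector_derivative_eq[where g = "\<lambda>i s. lie_iter f i (flow f s x)",
        OF open_greaterThanLessThan 1 0]
    by (simp add: flow_coeff_def taylor_coeff_def e)
  show "var_flow_coeff f i 0 x (mat 1) = (1 / fact i) *\<^sub>R lie_jacobian f i x"
    using iterated_vector_derivative_eq[where
        g = "\<lambda>i s. lie_jacobian f i (flow f s x) ** var_flow f s x (mat 1)",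
        OF open_greaterThanLessThan 2 0]
    by (simp add: var_flow_coeff_def taylor_coeff_def e)
qed

section \<open>The Hermite-Obreshkov formula\<close>

text \<open>The value of the Beta integral of \<open>s^q (s - h)^p\<close> over \<open>[0, h]\<close>, by repeated integration by parts.\<close>

lemma beta_primitive:
  "\<exists>G. (\<forall>s. (G has_real_derivative s ^ q * (s - h) ^ p) (at s)) \<and>
    G h - G 0 = (- 1) ^ p * h ^ (p + q + 1) * (fact p * fact q / fact (p + q + 1))"
proof (induction q arbitrary: p)
  case 0
  have "((\<lambda>s. (s - h) ^ (p + 1) / real (p + 1)) has_real_derivative s ^ 0 * (s - h) ^ p) (at s)" for s
  proof -
    have "((\<lambda>s. (s - h) ^ Suc p / real (Suc p)) has_real_derivative
        real (Suc p) * (s - h) ^ p / real (Suc p)) (at s)"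
      by (auto intro!: derivative_eq_intros simp del: power_Suc of_nat_Suc)
    then show ?thesis by (simp del: power_Suc of_nat_Suc)
  qed
  moreover have "(h - h) ^ (p + 1) / real (p + 1) - (0 - h) ^ (p + 1) / real (p + 1)
      = (- 1) ^ p * h ^ (p + 0 + 1) * (fact p * fact 0 / fact (p + 0 + 1))"
    by (simp add: power_minus[of h] divide_simps)
  ultimately show ?case by (intro exI[of _ "\<lambda>s. (s - h) ^ (p + 1) / real (p + 1)"]) simp
next
  case (Suc q)
  obtain G where G: "\<And>s. (G has_real_derivative s ^ q * (s - h) ^ (Suc p)) (at s)"
    "G h - G 0 = (- 1) ^ Suc p * h ^ (Suc p + q + 1) * (fact (Suc p) * fact q / fact (Suc p + q + 1))"
    using Suc.IH[of "Suc p"] by blast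
  define H where "H s = (s ^ Suc q * (s - h) ^ Suc p - real (Suc q) * G s) / real (Suc p)" for s
  have H': "(H has_real_derivative s ^ Suc q * (s - h) ^ p) (at s)" for s
  proof -
    have "(H has_real_derivative (real (Suc q) * s ^ q * (s - h) ^ Suc p
        + real (Suc p) * (s - h) ^ p * s ^ Suc q - real (Suc q) * (s ^ q * (s - h) ^ Suc p)) / real (Suc p)) (at s)"
      unfolding H_def by (rule derivative_eq_intros G refl | simp del: of_nat_Suc power_Suc)+
    then show ?thesis by (simp add: mult.commute del: of_nat_Suc power_Suc)
  qed
  have "H h - H 0 = - (real (Suc q) / real (Suc p)) * (G h - G 0)"
    by (simp add: H_def diff_divide_distrib right_diff_distrib del: of_nat_Suc)
  also have "\<dots> = (- 1) ^ p * h ^ (p + Suc q + 1) * (fact p * fact (Suc q) / fact (p + Suc q + 1))"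
    unfolding G(2) by (simp add: field_simps del: of_nat_Suc)
  finally show ?case using H' by (intro exI[of _ H] conjI allI)
qed

text \<open>After the shift by \<open>b\<close> the polynomial becomes \<open>x^l (x + b - a)^n\<close>, whose coefficients the binomial
  theorem gives.\<close>

lemma poly_higher_pderiv_linear_powers:
  "poly ((pderiv ^^ k) ([:- a, 1:] ^ n * [:- b, 1:] ^ l)) (b::real)
    = (if k < l then 0 else fact k * real (n choose (k - l)) * (b - a) ^ (n - (k - l)))"
proof -
  have "pcompose (pderiv P) [:b, 1:] = pderiv (pcompose P [:b, 1:])" for P :: "real poly"
    by (simp add: pderiv_pcompose pderiv_pCons)
  then have "pcompose ((pderiv ^^ k) P) [:b, 1:] = (pderiv ^^ k) (pcompose P [:b, 1:])"
    for P :: "real poly"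
    by (induction k) simp_all
  then have shift: "poly ((pderiv ^^ k) P) b = poly ((pderiv ^^ k) (pcompose P [:b, 1:])) 0" for P
    using poly_pcompose[of "(pderiv ^^ k) P" "[:b, 1:]" 0] by simp
  have at_0: "poly ((pderiv ^^ k) Q) 0 = fact k * coeff Q k" for Q :: "real poly"
    by (simp add: poly_0_coeff_0 coeff_higher_pderiv pochhammer_fact)
  have pow: "pcompose (P ^ j) R = pcompose P R ^ j" for P R :: "real poly" and j
    by (induction j) (simp_all add: pcompose_mult pcompose_1)
  have comp: "pcompose ([:- a, 1:] ^ n * [:- b, 1:] ^ l) [:b, 1:] = monom 1 l * [:b - a, 1:] ^ n"
    by (simp add: pcompose_mult pow pcompose_pCons monom_altdef mult.commute)
  have coeff: "coeff ([:c, 1:] ^ n) i = real (n choose i) * c ^ (n - i)" for c and i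
    by (cases "i \<le> n") (simp_all add: coeff_linear_poly_power coeff_eq_0 degree_linear_power)
  show ?thesis
    by (simp add: shift comp at_0 coeff_monom_mult coeff)
qed

lemma ho_c_fact:
  assumes "i \<le> n"
  shows "fact (n + l - i) * real (n choose i) = fact (n + l) * (ho_c n l i / fact i)"
proof -
  have "real ((l + n) choose i) = fact (n + l) / (fact i * fact (n + l - i))"
    using assms by (subst binomial_fact) (auto simp: add.commute)
  then show ?thesis using assms unfolding ho_c_def by (auto simp: divide_simps mult_ac)
qed

text \<open>The contribution of one endpoint to the boundary terms of a (n+l)-fold integration by parts
  against the kernel. The kernel vanishes to order \<open>l\<close> at the endpoint \<open>b\<close>, which removes all \<open>v i\<close>
  with \<open>i > n\<close>.\<close>

lemma alternating_endpoint_sum: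
  fixes v :: "nat \<Rightarrow> real"
  shows "(\<Sum>k\<le>n+l. (- 1) ^ k * poly ((pderiv ^^ k) ([:- a, 1:] ^ n * [:- b, 1:] ^ l)) b * v (n + l - k))
    = (- 1) ^ (n + l) * fact (n + l) * (\<Sum>i\<le>n. ho_c n l i * (a - b) ^ i * (v i / fact i))"
proof -
  define T where "T k = (- 1) ^ k * poly ((pderiv ^^ k) ([:- a, 1:] ^ n * [:- b, 1:] ^ l)) b * v (n + l - k)"
    for k
  have T0: "T (n + l - i) = 0" if "i \<in> {..n+l} - {..n}" for i
    using that by (auto simp: T_def poly_higher_pderiv_linear_powers)
  have T: "T (n + l - i) = (- 1) ^ (n + l) * fact (n + l) * (ho_c n l i * (a - b) ^ i * (v i / fact i))"
    if i: "i \<le> n" for i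
  proof -
    have "(n + l - i) - l = n - i" "n - (n - i) = i" "n + l - (n + l - i) = i"
      "\<not> n + l - i < l" using i by auto
    then have "T (n + l - i)
        = (- 1) ^ (n + l - i) * (b - a) ^ i * (fact (n + l - i) * real (n choose i)) * v i"
      using i binomial_symmetric[OF i] by (simp add: T_def poly_higher_pderiv_linear_powers)
    moreover have "(- 1) ^ (n + l - i) * (b - a) ^ i = (- 1) ^ (n + l) * (a - b) ^ i"
    proof -
      have "(- 1 :: real) ^ (n + l) = (- 1) ^ (n + l - i) * (- 1) ^ i"
        using i by (simp flip: power_add)
      moreover have "(- 1) ^ i * (a - b) ^ i = (b - a) ^ i" by (simp flip: power_mult_distrib)
      ultimately show ?thesis by (metis mult.assoc)
    qed
    ultimately show ?thesis by (simp only: ho_c_fact[OF i]) simp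
  qed
  have "(\<Sum>k\<le>n+l. T k) = (\<Sum>i\<le>n+l. T (n + l - i))"
    by (rule sum.nat_diff_reindex[symmetric, of "T" "Suc (n + l)", simplified lessThan_Suc_atMost diff_Suc_Suc])
  also have "\<dots> = (\<Sum>i\<le>n. T (n + l - i))"
    by (rule sum.mono_neutral_right) (use T0 in auto)
  finally show ?thesis unfolding T_def[symmetric] by (simp add: T sum_distrib_left)
qed

text \<open>Let \<open>K(s) = s^q (s - h)^p\<close> and \<open>m = p + q\<close>. The alternating sum \<open>E\<close> of the products of the k-th
  derivative of \<open>K\<close> and the (m-k)-th derivative of the function telescopes under differentiation to
  \<open>K u (m+1)\<close>. At \<open>h\<close> and at 0 it reduces to the two Hermite-Obreshkov sums, because \<open>K\<close> vanishes there to
  order \<open>p\<close> and \<open>q\<close>. Since \<open>K\<close> has no zero inside the interval, Cauchy's mean value theorem for \<open>E\<close> and a primitive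
  of \<open>K\<close> gives the remainder. For \<open>q = 0\<close> this is Taylor's formula with Lagrange remainder.\<close>

theorem hermite_obreshkov:
  fixes u :: "nat \<Rightarrow> real \<Rightarrow> real"
  assumes h: "h > 0"
    and u: "\<And>t i. t \<in> {0..h} \<Longrightarrow> (u i has_real_derivative u (Suc i) t) (at t)"
  obtains \<tau> where "\<tau> \<in> {0<..<h}"
    and "(\<Sum>i\<le>q. ho_c q p i * (- h) ^ i * (u i h / fact i))
      = (\<Sum>i\<le>p. ho_c p q i * h ^ i * (u i 0 / fact i))
        + (- 1) ^ q * ho_c q p q * (h ^ (p + q + 1) * (u (p + q + 1) \<tau> / fact (p + q + 1)))"
proof -
  define m where "m = p + q"
  define K where "K = [:0, 1:] ^ q * [:- h, 1:] ^ p"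
  define E where "E s = (\<Sum>k\<le>m. (- 1) ^ k * poly ((pderiv ^^ k) K) s * u (m - k) s)" for s
  have K: "poly K s = s ^ q * (s - h) ^ p" for s by (simp add: K_def)
  have degK: "degree K = m"
    by (simp add: K_def m_def degree_mult_eq degree_power_eq)
  obtain G where G: "\<And>s. (G has_real_derivative poly K s) (at s)"
    and Gh: "G h - G 0 = (- 1) ^ p * h ^ (m + 1) * (fact p * fact q / fact (m + 1))"
    using beta_primitive[where q = q and h = h and p = p] unfolding K m_def by blast
  have E: "(E has_real_derivative poly K s * u (Suc m) s) (at s)" if s: "s \<in> {0..h}" for s
  proof -
    define a where "a k = (- 1) ^ k * poly ((pderiv ^^ k) K) s * u (Suc m - k) s" for k
    have "((\<lambda>s. (- 1) ^ k * poly ((pderiv ^^ k) K) s * u (m - k) s) has_real_derivative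
        a k - a (Suc k)) (at s)" if "k \<le> m" for k
    proof -
      have "Suc m - k = Suc (m - k)" using that by simp
      then show ?thesis
        unfolding a_def
        by (auto intro!: derivative_eq_intros poly_DERIV u s simp: algebra_simps)
    qed
    then have "(E has_real_derivative (\<Sum>k\<le>m. a k - a (Suc k))) (at s)"
      unfolding E_def by (intro DERIV_sum) auto
    moreover have "(\<Sum>k\<le>m. a k - a (Suc k)) = a 0 - a (Suc m)" by (rule sum_telescope)
    moreover have "(pderiv ^^ Suc m) K = 0"
      using degree_higher_pderiv[of m K] degK
      by (simp add: pderiv_eq_0_iff)
    ultimately show ?thesis by (simp add: a_def)
  qed
  obtain \<tau> where \<tau>: "0 < \<tau>" "\<tau> < h"
    and mv: "(E h - E 0) * poly K \<tau> = (G h - G 0) * (poly K \<tau> * u (Suc m) \<tau>)"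
    using GMVT'[OF h DERIV_isCont[OF E] DERIV_isCont[OF G] G E] by auto
  have "poly K \<tau> \<noteq> 0" using \<tau> by (simp add: K)
  with mv have mv: "E h - E 0 = (G h - G 0) * u (Suc m) \<tau>" by (simp add: mult.left_commute)
  define A where "A = (\<Sum>i\<le>q. ho_c q p i * (- h) ^ i * (u i h / fact i))"
  define B where "B = (\<Sum>i\<le>p. ho_c p q i * h ^ i * (u i 0 / fact i))"
  have "E h = (- 1) ^ m * fact m * A"
    using alternating_endpoint_sum[where n = q and l = p and a = 0 and b = h and v = "\<lambda>i. u i h"]
    by (simp add: E_def A_def K_def m_def add.commute)
  moreover have "E 0 = (- 1) ^ m * fact m * B"
    using alternating_endpoint_sum[where n = p and l = q and a = h and b = 0 and v = "\<lambda>i. u i 0"]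
    by (simp add: E_def B_def K_def m_def mult.commute)
  ultimately have "(- 1) ^ m * fact m * (A - B) = (G h - G 0) * u (Suc m) \<tau>"
    using mv by (simp add: algebra_simps)
  also have "\<dots> = (- 1) ^ m * fact m * ((- 1) ^ q * ho_c q p q
      * (h ^ (m + 1) * (u (m + 1) \<tau> / fact (m + 1))))"
  proof -
    have "fact p * real (q choose q) = fact m * (ho_c q p q / fact q)"
      using ho_c_fact[of q q p] by (simp add: m_def add.commute)
    then have "fact p * fact q = fact m * ho_c q p q" by (simp add: field_simps)
    moreover have "(- 1 :: real) ^ p = (- 1) ^ m * (- 1) ^ q"
      by (simp add: m_def power_add flip: power_mult_distrib)
    ultimately show ?thesis unfolding Gh by simp
  qed
  finally have "A - B = (- 1) ^ q * ho_c q p q * (h ^ (m + 1) * (u (m + 1) \<tau> / fact (m + 1)))"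
    unfolding mult_cancel_left by simp
  then show thesis
    using that[of \<tau>] \<tau> unfolding A_def B_def m_def by (simp add: algebra_simps)
qed

section \<open>Interval objects and mean values\<close>

lemma enclosesD: "encloses X S \<Longrightarrow> v \<in> S \<Longrightarrow> v \<in> X"
  by (auto simp: encloses_def)

lemma interval_object_convex: "interval_object X \<Longrightarrow> convex X"
  by (auto simp: interval_object_def interval_cbox)

lemma mid_mem:
  assumes "interval_object X" "x \<in> X" shows "mid X \<in> X"
proof -
  obtain a b where X: "X = {a..b}" using assms(1) by (auto simp: interval_object_def)
  with assms(2) have "a \<le> b" by auto
  then have "mid X = midpoint a b" by (simp add: mid_def X)
  also have "\<dots> \<in> closed_segment a b" by (rule midpoint_in_closed_segment)
  also have "\<dots> \<subseteq> X"
    using \<open>a \<le> b\<close> by (intro closed_segment_subset interval_object_convex assms(1)) (auto simp: X)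
  finally show ?thesis .
qed

text \<open>Membership in a box is decided coordinate by coordinate. Mean value theorems for vector
  functions only provide a separate intermediate point for each coordinate; because the enclosures
  are boxes, the vector assembled from these points still lies in the enclosure.\<close>

lemma interval_object_vec_mem:
  fixes X :: "(real^'n) set"
  assumes "interval_object X" "\<And>j. \<exists>w\<in>X. v $ j = w $ j"
  shows "v \<in> X"
proof -
  obtain a b where X: "X = {a..b}" using assms(1) by (auto simp: interval_object_def)
  have "a $ j \<le> v $ j \<and> v $ j \<le> b $ j" for j
    using assms(2)[of j] by (auto simp: X less_eq_vec_def)
  then show ?thesis by (simp add: X less_eq_vec_def)
qed

lemma interval_object_mat_mem:
  fixes X :: "(real^'n^'m) set"
  assumes "interval_object X" "\<And>j k. \<exists>W\<in>X. M $ j $ k = W $ j $ k"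
  shows "M \<in> X"
proof -
  obtain a b where X: "X = {a..b}" using assms(1) by (auto simp: interval_object_def)
  have "a $ j $ k \<le> M $ j $ k \<and> M $ j $ k \<le> b $ j $ k" for j k
    using assms(2)[of j k] by (auto simp: X less_eq_vec_def)
  then show ?thesis by (simp add: X less_eq_vec_def)
qed

text \<open>The matrix \<open>M\<close> is assembled from the rows of derivatives at different points of \<open>X\<close>, one point
  for each component of \<open>F\<close>.\<close>

lemma interval_mean_value:
  fixes F :: "real^'n \<Rightarrow> real^'m"
  assumes F: "\<And>z. (F has_derivative (\<lambda>v. DF z *v v)) (at z)"
    and X: "convex X" "x \<in> X" "y \<in> X" and A: "encloses A (DF ` X)"
  obtains M where "M \<in> A" "F x - F y = M *v (x - y)"
proof -
  have "\<exists>\<xi>\<in>X. (F x - F y) $ j = (DF \<xi> *v (x - y)) $ j" for j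
  proof -
    define g where "g t = F (y + t *\<^sub>R (x - y)) $ j" for t
    define g' where "g' t = (DF (y + t *\<^sub>R (x - y)) *v (x - y)) $ j" for t
    have "(g has_real_derivative g' t) (at t)" for t
    proof -
      have "((\<lambda>t. F (y + t *\<^sub>R (x - y))) has_derivative
          (\<lambda>r. DF (y + t *\<^sub>R (x - y)) *v (r *\<^sub>R (x - y)))) (at t)"
        by (rule has_derivative_compose[OF _ F]) (auto intro!: derivative_eq_intros)
      then have "(g has_derivative (\<lambda>r. (DF (y + t *\<^sub>R (x - y)) *v (r *\<^sub>R (x - y))) $ j)) (at t)"
        unfolding g_def by (rule bounded_linear.has_derivative[OF bounded_linear_vec_nth])
      then show ?thesis
        by (simp add: has_field_derivative_def g'_def matrix_vector_mult_scaleR mult_commute_abs)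
    qed
    from MVT2[OF zero_less_one this] obtain t where t: "0 < t" "t < 1" "g 1 - g 0 = g' t" by auto
    have "y + t *\<^sub>R (x - y) = (1 - t) *\<^sub>R y + t *\<^sub>R x" by (simp add: algebra_simps)
    also have "\<dots> \<in> X" using X t by (intro convexD_alt) auto
    finally show ?thesis using t(3) by (intro bexI) (auto simp: g_def g'_def)
  qed
  then obtain \<xi> where \<xi>: "\<And>j. \<xi> j \<in> X" "\<And>j. (F x - F y) $ j = (DF (\<xi> j) *v (x - y)) $ j"
    by metis
  define M where "M = (\<chi> j. DF (\<xi> j) $ j)"
  show thesis
  proof
    show "M \<in> A"
      using A \<xi>(1) by (intro interval_object_mat_mem) (auto simp: encloses_def M_def)
    show "F x - F y = M *v (x - y)"
      unfolding vec_eq_iff \<xi>(2) by (simp add: M_def matrix_vector_mult_def)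
  qed
qed

lemma sum_matrix_vector_mult:
  "(\<Sum>i\<in>S. A i) *v (v::real^'n) = (\<Sum>i\<in>S. A i *v v)"
  by (induction S rule: infinite_finite_induct) (simp_all add: matrix_vector_mult_add_rdistrib)

lemma matrix_mult_add_left: "(A + B) ** (C::real^'n^'m) = A ** C + B ** C"
  by (simp add: vec_eq_iff matrix_matrix_mult_def distrib_right sum.distrib)

lemma matrix_mult_diff_left: "(A - B) ** (C::real^'n^'m) = A ** C - B ** C"
  by (simp add: vec_eq_iff matrix_matrix_mult_def left_diff_distrib sum_subtractf)

lemma sum_matrix_mult:
  "(\<Sum>i\<in>S. A i) ** (B::real^'n^'m) = (\<Sum>i\<in>S. A i ** B)"
  by (induction S rule: infinite_finite_induct) (simp_all add: matrix_mult_add_left ) 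

section \<open>The Hermite-Obreshkov formula for the flow\<close>

lemma has_derivative_HO:
  assumes "smooth f"
  shows "(HO f q p s has_derivative (\<lambda>v. D_HO f q p s x *v v)) (at x)"
proof -
  have "((\<lambda>x. \<Sum>i\<le>q. (ho_c q p i * s ^ i) *\<^sub>R ((1 / fact i) *\<^sub>R lie_iter f i x)) has_derivative
     (\<lambda>v. \<Sum>i\<le>q. (ho_c q p i * s ^ i) *\<^sub>R ((1 / fact i) *\<^sub>R (lie_jacobian f i x *v v)))) (at x)"
    by (intro has_derivative_sum has_derivative_scaleR_right has_derivative_lie_iter assms)
  then show ?thesis
    by (simp add: HO_def[abs_def] D_HO_def flow_coeff_eq_lie[OF assms] var_flow_coeff_eq_lie[OF assms]
        sum_matrix_vector_mult scaleR_matrix_vector_assoc)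
qed

text \<open>The real Hermite-Obreshkov formula in each coordinate. The coefficients at time \<open>h\<close> are
  those at time 0 of the point \<open>flow f h x\<close>, by \<open>flow_coeff_eq_lie\<close>. The box \<open>X\<close> collects the remainders with
  different intermediate times.\<close>

lemma hermite_obreshkov_flow:
  assumes f: "smooth f" and h: "h > 0" and ex: "h \<in> existence_ivl f x" and X: "interval_object X"
    and enc: "\<And>\<tau>. \<tau> \<in> {0..h} \<Longrightarrow> h ^ (p + q + 1) *\<^sub>R flow_coeff f (p + q + 1) 0 (flow f \<tau> x) \<in> X"
  obtains v where "v \<in> X"
    "HO f q p (- h) (flow f h x) = HO f p q h x + ((- 1) ^ q * ho_c q p q) *\<^sub>R v"
proof -
  obtain e where e: "e > 0" "flow f 0 x = x"
    and D: "\<And>t i. t \<in> {-e<..<h+e} \<Longrightarrow>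
      ((\<lambda>s. lie_iter f i (flow f s x)) has_vector_derivative lie_iter f (Suc i) (flow f t x)) (at t)"
    by (rule flow_derivatives[OF f less_imp_le[OF h] ex]) blast
  have "\<exists>\<tau>\<in>{0..h}. HO f q p (- h) (flow f h x) $ j = HO f p q h x $ j
      + (- 1) ^ q * ho_c q p q * (h ^ (p + q + 1) *\<^sub>R flow_coeff f (p + q + 1) 0 (flow f \<tau> x)) $ j" for j
  proof -
    have "((\<lambda>s. lie_iter f i (flow f s x) $ j) has_real_derivative lie_iter f (Suc i) (flow f t x) $ j) (at t)"
      if "t \<in> {0..h}" for t i
      unfolding has_real_derivative_iff_has_vector_derivative
      using that e by (intro bounded_linear.has_vector_derivative[OF bounded_linear_vec_nth D]) auto
    from hermite_obreshkov[where u = "\<lambda>i s. lie_iter f i (flow f s x) $ j", OF h this, of q p]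
    obtain \<tau> where "\<tau> \<in> {0<..<h}"
      "(\<Sum>i\<le>q. ho_c q p i * (- h) ^ i * (lie_iter f i (flow f h x) $ j / fact i))
      = (\<Sum>i\<le>p. ho_c p q i * h ^ i * (lie_iter f i (flow f 0 x) $ j / fact i))
        + (- 1) ^ q * ho_c q p q * (h ^ (p + q + 1) * (lie_iter f (p + q + 1) (flow f \<tau> x) $ j / fact (p + q + 1)))"
      by blast
    then show ?thesis
      by (intro bexI[of _ \<tau>]) (auto simp: HO_def flow_coeff_eq_lie[OF f] e)
  qed
  then obtain \<tau> where \<tau>: "\<And>j. \<tau> j \<in> {0..h}" "\<And>j. HO f q p (- h) (flow f h x) $ j = HO f p q h x $ j
      + (- 1) ^ q * ho_c q p q * (h ^ (p + q + 1) *\<^sub>R flow_coeff f (p + q + 1) 0 (flow f (\<tau> j) x)) $ j"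
    by metis
  define v where "v = (\<chi> j. (h ^ (p + q + 1) *\<^sub>R flow_coeff f (p + q + 1) 0 (flow f (\<tau> j) x)) $ j)"
  show thesis
  proof
    show "v \<in> X"
      using enc[OF \<tau>(1)] by (intro interval_object_vec_mem[OF X]) (auto simp: v_def simp del: vector_scaleR_component)
    show "HO f q p (- h) (flow f h x) = HO f p q h x + ((- 1) ^ q * ho_c q p q) *\<^sub>R v"
      unfolding vec_eq_iff \<tau>(2) by (simp add: v_def)
  qed
qed

text \<open>The same formula for the entries of the variational flow, whose i-th time derivative is the
  derivative at time 0 from the current point, multiplied from the right by the variational flow.\<close>

lemma hermite_obreshkov_var_flow:
  assumes f: "smooth f" and h: "h > 0" and ex: "h \<in> existence_ivl f x" and X: "interval_object X"
    and enc: "\<And>\<tau>. \<tau> \<in> {0..h} \<Longrightarrow> h ^ (p + q + 1) *\<^sub>R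
      (var_flow_coeff f (p + q + 1) 0 (flow f \<tau> x) (mat 1) ** var_flow f \<tau> x (mat 1)) \<in> X"
  obtains N where "N \<in> X"
    "D_HO f q p (- h) (flow f h x) ** var_flow f h x (mat 1)
      = D_HO f p q h x + ((- 1) ^ q * ho_c q p q) *\<^sub>R N"
proof -
  obtain e where e: "e > 0" "flow f 0 x = x" "var_flow f 0 x (mat 1) = mat 1"
    and D: "\<And>t i. t \<in> {-e<..<h+e} \<Longrightarrow>
      ((\<lambda>s. lie_jacobian f i (flow f s x) ** var_flow f s x (mat 1)) has_vector_derivative
        lie_jacobian f (Suc i) (flow f t x) ** var_flow f t x (mat 1)) (at t)"
    by (rule flow_derivatives[OF f less_imp_le[OF h] ex]) blast
  define \<Psi> where "\<Psi> i t = lie_jacobian f i (flow f t x) ** var_flow f t x (mat 1)" for i t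
  have coeff: "var_flow_coeff f i 0 (flow f t x) (mat 1) ** var_flow f t x (mat 1)
      = (1 / fact i) *\<^sub>R \<Psi> i t" for i t
    by (simp add: var_flow_coeff_eq_lie[OF f] \<Psi>_def scalar_matrix_assoc[symmetric])
  have left: "D_HO f q p (- h) (flow f h x) ** var_flow f h x (mat 1)
      = (\<Sum>i\<le>q. (ho_c q p i * (- h) ^ i) *\<^sub>R ((1 / fact i) *\<^sub>R \<Psi> i h))"
    by (simp add: D_HO_def sum_matrix_mult scalar_matrix_assoc[symmetric] coeff[symmetric])
  have right: "D_HO f p q h x = (\<Sum>i\<le>p. (ho_c p q i * h ^ i) *\<^sub>R ((1 / fact i) *\<^sub>R \<Psi> i 0))"
    by (simp add: D_HO_def var_flow_coeff_eq_lie[OF f] \<Psi>_def e)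
  have "\<exists>\<tau>\<in>{0..h}. (D_HO f q p (- h) (flow f h x) ** var_flow f h x (mat 1)) $ j $ k
      = D_HO f p q h x $ j $ k + (- 1) ^ q * ho_c q p q *
        (h ^ (p + q + 1) *\<^sub>R ((1 / fact (p + q + 1)) *\<^sub>R \<Psi> (p + q + 1) \<tau>)) $ j $ k" for j k
  proof -
    have "((\<lambda>s. \<Psi> i s $ j $ k) has_real_derivative \<Psi> (Suc i) t $ j $ k) (at t)"
      if "t \<in> {0..h}" for t i
      unfolding has_real_derivative_iff_has_vector_derivative \<Psi>_def
      using that e by (intro bounded_linear.has_vector_derivative[OF bounded_linear_vec_nth] D) auto
    from hermite_obreshkov[where u = "\<lambda>i s. \<Psi> i s $ j $ k", OF h this, of q p]
    obtain \<tau> where "\<tau> \<in> {0<..<h}"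
      "(\<Sum>i\<le>q. ho_c q p i * (- h) ^ i * (\<Psi> i h $ j $ k / fact i))
      = (\<Sum>i\<le>p. ho_c p q i * h ^ i * (\<Psi> i 0 $ j $ k / fact i))
        + (- 1) ^ q * ho_c q p q * (h ^ (p + q + 1) * (\<Psi> (p + q + 1) \<tau> $ j $ k / fact (p + q + 1)))"
      by blast
    then show ?thesis
      by (intro bexI[of _ \<tau>]) (auto simp: left right)
  qed
  then obtain \<tau> where \<tau>: "\<And>j k. \<tau> j k \<in> {0..h}"
    "\<And>j k. (D_HO f q p (- h) (flow f h x) ** var_flow f h x (mat 1)) $ j $ k
      = D_HO f p q h x $ j $ k + (- 1) ^ q * ho_c q p q *
        (h ^ (p + q + 1) *\<^sub>R ((1 / fact (p + q + 1)) *\<^sub>R \<Psi> (p + q + 1) (\<tau> j k))) $ j $ k"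
    by metis
  define N where "N = (\<chi> j k.
    (h ^ (p + q + 1) *\<^sub>R ((1 / fact (p + q + 1)) *\<^sub>R \<Psi> (p + q + 1) (\<tau> j k))) $ j $ k)"
  show thesis
  proof
    show "N \<in> X"
      using enc[OF \<tau>(1), unfolded coeff]
      by (intro interval_object_mat_mem[OF X]) (auto simp: N_def simp del: vector_scaleR_component)
    show "D_HO f q p (- h) (flow f h x) ** var_flow f h x (mat 1)
      = D_HO f p q h x + ((- 1) ^ q * ho_c q p q) *\<^sub>R N"
      unfolding vec_eq_iff \<tau>(2) by (simp add: N_def)
  qed
qed

text \<open>For \<open>q = 0\<close> the implicit side of the formula is trivial and the explicit side is the Taylor
  polynomial, so that predictor and corrector rest on the same formula.\<close>

lemma HO_0_left: "smooth f \<Longrightarrow> HO f 0 m s x = x"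
  by (simp add: HO_def ho_c_def flow_coeff_eq_lie)

lemma D_HO_0_left: "smooth f \<Longrightarrow> D_HO f 0 m s x = mat 1"
  by (simp add: D_HO_def ho_c_def var_flow_coeff_eq_lie)

lemma ho_c_0_right: "i \<le> m \<Longrightarrow> ho_c m 0 i = 1"
  by (simp add: ho_c_def)

lemma HO_0_right: "HO f m 0 s x = (\<Sum>i\<le>m. s ^ i *\<^sub>R flow_coeff f i 0 x)"
  by (simp add: HO_def ho_c_0_right)

lemma D_HO_0_right: "D_HO f m 0 s x = (\<Sum>i\<le>m. s ^ i *\<^sub>R var_flow_coeff f i 0 x (mat 1))"
  by (simp add: D_HO_def ho_c_0_right)

section \<open>Correctness of predictor and corrector\<close>

lemma predictor_remainders:
  assumes h: "h > 0" and x: "x \<in> xk" and \<tau>: "\<tau> \<in> {0..h}"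
    and ytil: "{flow f t x | t x. t \<in> {0..h} \<and> x \<in> xk} \<subseteq> ytil"
    and Vtil: "{var_flow f t x (mat 1) | t x. t \<in> {0..h} \<and> x \<in> xk} \<subseteq> Vtil"
    and pred: "predictor f m h xk ytil Vtil x0 r0 V0 R0"
  shows "h ^ (m + 1) *\<^sub>R flow_coeff f (m + 1) 0 (flow f \<tau> x) \<in> r0"
    and "h ^ (m + 1) *\<^sub>R (var_flow_coeff f (m + 1) 0 (flow f \<tau> x) (mat 1) ** var_flow f \<tau> x (mat 1)) \<in> R0"
proof -
  obtain \<Phi>r \<Psi>r where
    enc: "encloses \<Phi>r ((\<lambda>x. flow_coeff f (m + 1) 0 x) ` ytil)"
      "encloses \<Psi>r ((\<lambda>x. var_flow_coeff f (m + 1) 0 x (mat 1)) ` ytil)"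
      "encloses r0 {s ^ (m + 1) *\<^sub>R v | s v. s \<in> {0..h} \<and> v \<in> \<Phi>r}"
      "encloses R0 {s ^ (m + 1) *\<^sub>R (M ** W) | s M W. s \<in> {0..h} \<and> M \<in> \<Psi>r \<and> W \<in> Vtil}"
    using pred unfolding predictor_def by blast
  have y: "flow f \<tau> x \<in> ytil" using ytil x \<tau> by blast
  have W: "var_flow f \<tau> x (mat 1) \<in> Vtil" using Vtil x \<tau> by blast
  have hh: "h \<in> {0..h}" using h by simp
  have "flow_coeff f (m + 1) 0 (flow f \<tau> x) \<in> \<Phi>r" using enc(1) y unfolding encloses_def by blast
  then show "h ^ (m + 1) *\<^sub>R flow_coeff f (m + 1) 0 (flow f \<tau> x) \<in> r0"
    using enc(3) hh unfolding encloses_def by blast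
  have "var_flow_coeff f (m + 1) 0 (flow f \<tau> x) (mat 1) \<in> \<Psi>r"
    using enc(2) y unfolding encloses_def by blast
  then show "h ^ (m + 1) *\<^sub>R (var_flow_coeff f (m + 1) 0 (flow f \<tau> x) (mat 1) ** var_flow f \<tau> x (mat 1)) \<in> R0"
    using enc(4) hh W unfolding encloses_def by blast
qed

text \<open>The Taylor polynomial at \<open>x\<close> lies in both operands of the intersection: in the second by direct
  evaluation, in the first by its mean value form around the midpoint. For the variational flow, the
  Taylor polynomial is the space derivative of the former one.\<close>

theorem predictor_encloses:
  assumes f: "smooth f" and h: "h > 0" and xk: "interval_object xk" and x: "x \<in> xk"
    and ex: "h \<in> existence_ivl f x"
    and ytil: "{flow f t x | t x. t \<in> {0..h} \<and> x \<in> xk} \<subseteq> ytil"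
    and Vtil: "{var_flow f t x (mat 1) | t x. t \<in> {0..h} \<and> x \<in> xk} \<subseteq> Vtil"
    and pred: "predictor f m h xk ytil Vtil x0 r0 V0 R0"
  shows "flow f h x \<in> x0" and "var_flow f h x (mat 1) \<in> V0"
proof -
  obtain \<Phi> \<Psi> A y0 y B where
    \<Phi>: "\<forall>i\<le>m. encloses (\<Phi> i) ((\<lambda>x. flow_coeff f i 0 x) ` xk)"
    and \<Psi>: "\<forall>i\<le>m. encloses (\<Psi> i) ((\<lambda>x. var_flow_coeff f i 0 x (mat 1)) ` xk)"
    and A: "encloses A {\<Sum>i\<le>m. h ^ i *\<^sub>R M i | M. \<forall>i\<le>m. M i \<in> \<Psi> i}"
    and y0: "encloses y0 {\<Sum>i\<le>m. h ^ i *\<^sub>R flow_coeff f i 0 (mid xk)}"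
    and y: "encloses y {\<Sum>i\<le>m. h ^ i *\<^sub>R v i | v. \<forall>i\<le>m. v i \<in> \<Phi> i}"
    and B: "encloses B {u + a *v (x - mid xk) | u a x. u \<in> y0 \<and> a \<in> A \<and> x \<in> xk}"
    and x0: "encloses x0 {b + r | b r. b \<in> B \<inter> y \<and> r \<in> r0}"
    and V0: "encloses V0 {a + R | a R. a \<in> A \<and> R \<in> R0}"
    using pred unfolding predictor_def by (elim exE conjE) (rule that; assumption)
  have r0: "interval_object r0" and R0: "interval_object R0"
    using pred unfolding predictor_def encloses_def by blast+
  note rem = predictor_remainders[OF h x _ ytil Vtil pred]
  have DA: "D_HO f m 0 h z \<in> A" if "z \<in> xk" for z
  proof -
    have "\<forall>i\<le>m. var_flow_coeff f i 0 z (mat 1) \<in> \<Psi> i" using \<Psi> that unfolding encloses_def by blast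
    then show ?thesis
      unfolding D_HO_0_right
      by (intro enclosesD[OF A] CollectI exI[of _ "\<lambda>i. var_flow_coeff f i 0 z (mat 1)"] conjI refl)
  qed
  have A': "encloses A (D_HO f m 0 h ` xk)" using A DA unfolding encloses_def by blast
  obtain M where M: "M \<in> A" "HO f m 0 h x - HO f m 0 h (mid xk) = M *v (x - mid xk)"
    by (rule interval_mean_value[OF has_derivative_HO[OF f] interval_object_convex[OF xk] x
          mid_mem[OF xk x] A'])
  have "HO f m 0 h (mid xk) \<in> y0" using y0 unfolding encloses_def HO_0_right by blast
  moreover have "HO f m 0 h x = HO f m 0 h (mid xk) + M *v (x - mid xk)"
    using M(2) by (simp add: algebra_simps)
  ultimately have "HO f m 0 h x \<in> B" using B M(1) x unfolding encloses_def by blast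
  moreover have "HO f m 0 h x \<in> y"
  proof -
    have "\<forall>i\<le>m. flow_coeff f i 0 x \<in> \<Phi> i" using \<Phi> x unfolding encloses_def by blast
    then show ?thesis
      unfolding HO_0_right
      by (intro enclosesD[OF y] CollectI exI[of _ "\<lambda>i. flow_coeff f i 0 x"] conjI refl)
  qed
  moreover obtain v where "v \<in> r0"
    "HO f 0 m (- h) (flow f h x) = HO f m 0 h x + ((- 1) ^ 0 * ho_c 0 m 0) *\<^sub>R v"
    by (rule hermite_obreshkov_flow[OF f h ex r0, of m 0]) (use rem(1) in auto)
  ultimately show "flow f h x \<in> x0"
    using x0 unfolding encloses_def by (auto simp: HO_0_left[OF f] ho_c_def)
  obtain N where "N \<in> R0"
    "D_HO f 0 m (- h) (flow f h x) ** var_flow f h x (mat 1)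
      = D_HO f m 0 h x + ((- 1) ^ 0 * ho_c 0 m 0) *\<^sub>R N"
    by (rule hermite_obreshkov_var_flow[OF f h ex R0, of m 0]) (use rem(2) in auto)
  then show "var_flow f h x (mat 1) \<in> V0"
    using V0 DA[OF x] unfolding encloses_def by (auto simp: D_HO_0_left[OF f] ho_c_def)
qed

text \<open>The corrector solves the identity of \<open>hermite_obreshkov_flow\<close> for the new point \<open>y\<close>. By the mean value
  theorem around both midpoints the identity reads
  \<open>Mm (y - mid x0) = d + c v + Mp (x - mid xk)\<close>. Multiplying by \<open>J\<close> and adding
  \<open>(1 - J Mm) (y - mid x0)\<close> gives an expression for \<open>y - mid x0\<close> that the corrector evaluates, with the
  predictor enclosing the occurrence of \<open>y\<close> on the right.
  The variational flow is treated in the same way.\<close>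

theorem lemma3:
  fixes f :: "real^'n \<Rightarrow> real^'n" and p q m :: nat and h :: real
    and xk ytil x0 r0 xk1 :: "(real^'n) set"
    and Vtil V0 R0 Jm V :: "(real^'n^'n) set"
  assumes "smooth f"
    and "p > 0" and "q > 0" and "m = p + q" and "h > 0"
    and "interval_object xk" and "interval_object ytil" and "interval_object Vtil"
    and "\<forall>x\<in>xk. {0..h} \<subseteq> existence_ivl f x"
    and "{flow f t x | t x. t \<in> {0..h} \<and> x \<in> xk} \<subseteq> ytil"
    and "{var_flow f t x (mat 1) | t x. t \<in> {0..h} \<and> x \<in> xk} \<subseteq> Vtil"
    and "predictor f m h xk ytil Vtil x0 r0 V0 R0"
    and "corrector f p q h xk x0 r0 V0 R0 Jm xk1 V"
    and "invertible (mid Jm)"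
  shows "(\<lambda>x. flow f h x) ` xk \<subseteq> xk1 \<and> (\<lambda>x. var_flow f h x (mat 1)) ` xk \<subseteq> V"
proof -
  define J where "J = matrix_inv (mid Jm)"
  obtain \<delta> \<epsilon> Jp S r R B C where
    \<delta>: "encloses \<delta> {HO f p q h (mid xk) - HO f q p (- h) (mid x0)}"
    and \<epsilon>: "encloses \<epsilon> {((- 1) ^ q * ho_c q p q) *\<^sub>R v | v. v \<in> r0}"
    and Jm: "encloses Jm ((\<lambda>x. D_HO f q p (- h) x) ` x0)"
    and Jp: "encloses Jp ((\<lambda>x. D_HO f p q h x) ` xk)"
    and S: "encloses S {mat 1 - J ** M | M. M \<in> Jm}"
    and r: "encloses r {J *v (d + e) + s *v (x - mid x0) | d e s x.
                    d \<in> \<delta> \<and> e \<in> \<epsilon> \<and> s \<in> S \<and> x \<in> x0}"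
    and R: "encloses R {J ** (M + ((- 1) ^ q * ho_c q p q) *\<^sub>R N) | M N. M \<in> Jp \<and> N \<in> R0}"
    and B: "encloses B {mid x0 + (J ** M) *v (x - mid xk) + v | M x v. M \<in> Jp \<and> x \<in> xk \<and> v \<in> r}"
    and xk1: "encloses xk1 (B \<inter> x0)"
    and C: "encloses C {a + s ** W | a s W. a \<in> R \<and> s \<in> S \<and> W \<in> V0}"
    and V: "encloses V (C \<inter> V0)"
    using assms(13) unfolding corrector_def J_def[symmetric] by (elim exE conjE) (rule that; assumption)
  have boxes: "interval_object x0" "interval_object r0" "interval_object R0"
    using assms(12) unfolding predictor_def encloses_def by blast+
  have "flow f h x \<in> xk1 \<and> var_flow f h x (mat 1) \<in> V" if x: "x \<in> xk" for x
  proof -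
    define y where "y = flow f h x"
    define W where "W = var_flow f h x (mat 1)"
    define c where "c = (- 1) ^ q * ho_c q p q"
    have "h \<in> {0..h}" using assms(5) by simp
    then have ex: "h \<in> existence_ivl f x" using assms(9) x by blast
    have y: "y \<in> x0" and W: "W \<in> V0"
      unfolding y_def W_def
      using predictor_encloses[OF assms(1,5,6) x ex assms(10-12)] by blast+
    note rem = predictor_remainders[OF assms(5) x _ assms(10-12), unfolded assms(4)]
    obtain v where v: "v \<in> r0" "HO f q p (- h) y = HO f p q h x + c *\<^sub>R v"
      unfolding y_def c_def by (rule hermite_obreshkov_flow[OF assms(1,5) ex boxes(2) rem(1)])
    obtain Mm where Mm: "Mm \<in> Jm" "HO f q p (- h) y - HO f q p (- h) (mid x0) = Mm *v (y - mid x0)"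
      by (rule interval_mean_value[OF has_derivative_HO[OF assms(1)]
            interval_object_convex[OF boxes(1)] y mid_mem[OF boxes(1) y] Jm])
    obtain Mp where Mp: "Mp \<in> Jp" "HO f p q h x - HO f p q h (mid xk) = Mp *v (x - mid xk)"
      by (rule interval_mean_value[OF has_derivative_HO[OF assms(1)]
            interval_object_convex[OF assms(6)] x mid_mem[OF assms(6) x] Jp])
    define d where "d = HO f p q h (mid xk) - HO f q p (- h) (mid x0)"
    have d: "d \<in> \<delta>" using \<delta> by (simp add: encloses_def d_def)
    have e: "c *\<^sub>R v \<in> \<epsilon>" using \<epsilon> v(1) unfolding encloses_def c_def by blast
    have s: "mat 1 - J ** Mm \<in> S" using S Mm(1) unfolding encloses_def by blast
    define \<rho> where "\<rho> = J *v (d + c *\<^sub>R v) + (mat 1 - J ** Mm) *v (y - mid x0)"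
    have \<rho>: "\<rho> \<in> r" using r d e s y unfolding encloses_def \<rho>_def by blast
    have "Mm *v (y - mid x0) = d + c *\<^sub>R v + Mp *v (x - mid xk)"
      unfolding d_def Mm(2)[symmetric] Mp(2)[symmetric] v(2) by simp
    then have "J *v (Mm *v (y - mid x0)) = J *v (d + c *\<^sub>R v) + J *v (Mp *v (x - mid xk))"
      by (simp only: matrix_vector_right_distrib)
    then have "y = mid x0 + (J ** Mp) *v (x - mid xk) + \<rho>"
      by (simp add: \<rho>_def matrix_vector_mult_diff_rdistrib matrix_vector_mul_assoc[symmetric])
    then have "y \<in> B" using B Mp(1) x \<rho> unfolding encloses_def by blast
    then have "y \<in> xk1" using xk1 y unfolding encloses_def by blast
    moreover have "W \<in> V"
    proof -
      obtain N where N: "N \<in> R0" "D_HO f q p (- h) y ** W = D_HO f p q h x + c *\<^sub>R N"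
        unfolding y_def W_def c_def
        by (rule hermite_obreshkov_var_flow[OF assms(1,5) ex boxes(3) rem(2)])
      have "D_HO f q p (- h) y \<in> Jm" using Jm y unfolding encloses_def by blast
      then have s: "mat 1 - J ** D_HO f q p (- h) y \<in> S" using S unfolding encloses_def by blast
      have "D_HO f p q h x \<in> Jp" using Jp x unfolding encloses_def by blast
      then have a: "J ** (D_HO f p q h x + c *\<^sub>R N) \<in> R"
        using R N(1) unfolding encloses_def c_def by blast
      have "W = J ** (D_HO f p q h x + c *\<^sub>R N) + (mat 1 - J ** D_HO f q p (- h) y) ** W"
        by (simp add: N(2)[symmetric] matrix_mult_diff_left matrix_mul_assoc)
      then have "W \<in> C" using C a s W unfolding encloses_def by blast
      then show ?thesis using V W unfolding encloses_def by blast
    qed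
    ultimately show ?thesis by (simp add: y_def W_def)
  qed
  then show ?thesis by blast
qed

end
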